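(* Let $\nabla$ and $\nabla^*$ be dual connections on a (pseudo-)Riemannian manifold $(M,g)$ and $\alpha\in\mathbb R$. Then the Einstein tensor of the $\alpha$-connection $\nabla^{(\alpha)}=\frac{1+\alpha}{2}\nabla+\frac{1-\alpha}{2}\nabla^*$ is given, in any local coordinates, by $$G^{(\alpha)}_{ij}=\frac{1+\alpha}{2}G_{ij}+\frac{1-\alpha}{2}G^*_{ij}+\frac{1-\alpha^2}{4}H_{ij},\qquad H_{ij}:=\mathcal K_{(ij)}-\frac12g_{ij}\mathcal K,$$ where $G_{ij}$ and $G^*_{ij}$ are the Einstein tensors of $\nabla$ and $\nabla^*$.
   Context: Connections are affine connections, possibly with torsion. $\nabla$ and $\nabla^*$ are ($g$-)dual if $X(g(Y,Z))=g(\nabla_XY,Z)+g(Y,\nabla^*_XZ)$ for all vector fields. The difference tensor is $K(X,Y)=\nabla^*_XY-\nabla_XY$, with components in this statement given by $K(\partial_i,\partial_l)=K^m_{\ il}\partial_m$. Put $\mathcal K_{lj}:=K^m_{\ il}K^i_{\ jm}-K^i_{\ im}K^m_{\ jl}$, $\mathcal K:=g^{lj}\mathcal K_{lj}$, and $\mathcal K_{(ij)}:=\frac12(\mathcal K_{ij}+\mathcal K_{ji})$. Curvature: $R(X,Y)Z=\nabla_X\nabla_YZ-\nabla_Y\nabla_XZ-\nabla_{[X,Y]}Z$, components $R(\partial_k,\partial_l)\partial_i=R_{i\ kl}^{\ j}\partial_j$; Ricci tensor $R_{lj}=R_{l\ ij}^{\ i}$ (sum over $i$); $R_{(ij)}=\frac12(R_{ij}+R_{ji})$;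 Ricci scalar $R=g^{lj}R_{lj}$. The Einstein tensor of a connection is $R_{(ij)}-\frac12g_{ij}R$ formed from its own Ricci tensor and scalar; $G$, $G^*$, $G^{(\alpha)}$ refer to $\nabla$, $\nabla^*$, $\nabla^{(\alpha)}$. Summation over repeated indices is understood. *)

theory Defs
  imports "HOL-Analysis.Analysis"
begin

text \<open>
  A manifold of dimension \<open>CARD('n)\<close> is a Hausdorff, second countable topological space, given as
  a type \<open>'a\<close>, with a maximal smooth atlas \<open>A\<close>. A chart is a pair of its domain and
  its coordinate map; the latter is a total function whose values off the domain are irrelevant.
\<close>

type_synonym ('a, 'n) chart = "'a set \<times> ('a \<Rightarrow> real ^ 'n)"
type_synonym 'a tvec = "('a \<Rightarrow> real) \<Rightarrow> real"
type_synonym 'a vfield = "'a \<Rightarrow> 'a tvec"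
type_synonym 'a connection = "'a vfield \<Rightarrow> 'a vfield \<Rightarrow> 'a vfield"

section \<open>Smooth manifolds\<close>

text \<open>Only meant for open sets \<open>S\<close>.\<close>

primrec Ck_on :: "nat \<Rightarrow> ('a::real_normed_vector \<Rightarrow> 'b::real_normed_vector) \<Rightarrow> 'a set \<Rightarrow> bool" where
  "Ck_on 0 f S \<longleftrightarrow> continuous_on S f"
| "Ck_on (Suc k) f S \<longleftrightarrow>
     (\<forall>x\<in>S. f differentiable (at x)) \<and>
     (\<forall>v. Ck_on k (\<lambda>x. frechet_derivative f (at x) v) S)"

definition smooth_on :: "'a set \<Rightarrow> ('a::real_normed_vector \<Rightarrow> 'b::real_normed_vector) \<Rightarrow> bool" where
  "smooth_on S f \<longleftrightarrow> (\<forall>k. Ck_on k f S)"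

definition chart_inv :: "('a, 'n) chart \<Rightarrow> real ^ 'n \<Rightarrow> 'a" where
  "chart_inv c = inv_into (fst c) (snd c)"

definition is_chart :: "('a::topological_space, 'n::finite) chart \<Rightarrow> bool" where
  "is_chart c \<longleftrightarrow> open (fst c) \<and> open (snd c ` fst c) \<and>
     homeomorphism (fst c) (snd c ` fst c) (snd c) (chart_inv c)"

definition compatible :: "('a, 'n::finite) chart \<Rightarrow> ('a, 'n) chart \<Rightarrow> bool" where
  "compatible c d \<longleftrightarrow>
     smooth_on (snd c ` (fst c \<inter> fst d)) (snd d \<circ> chart_inv c) \<and>
     smooth_on (snd d ` (fst c \<inter> fst d)) (snd c \<circ> chart_inv d)"

definition smooth_structure ::
  "('a::{t2_space, second_countable_topology}, 'n::finite) chart set \<Rightarrow> bool" where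
  "smooth_structure A \<longleftrightarrow>
     (\<forall>c\<in>A. is_chart c) \<and>
     (\<Union>c\<in>A. fst c) = UNIV \<and>
     (\<forall>c\<in>A. \<forall>d\<in>A. compatible c d) \<and>
     (\<forall>c. is_chart c \<and> (\<forall>d\<in>A. compatible c d) \<longrightarrow> c \<in> A)"

definition smooth_fun :: "('a, 'n::finite) chart set \<Rightarrow> ('a \<Rightarrow> real) \<Rightarrow> bool" where
  "smooth_fun A f \<longleftrightarrow> (\<forall>c\<in>A. smooth_on (snd c ` fst c) (f \<circ> chart_inv c))"

text \<open>
  Tangent vectors at \<open>p\<close> are derivations at \<open>p\<close> of the algebra of smooth functions. As functionals on
  all functions they are made unique by the value \<open>0\<close> on non-smooth functions, so that equality of
  tangent vectors and of vector fields is equality in HOL.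
\<close>

definition tangent_space :: "('a, 'n::finite) chart set \<Rightarrow> 'a \<Rightarrow> 'a tvec set" where
  "tangent_space A p = {v.
     (\<forall>f. \<not> smooth_fun A f \<longrightarrow> v f = 0) \<and>
     (\<forall>f h. smooth_fun A f \<and> smooth_fun A h \<longrightarrow> v (\<lambda>x. f x + h x) = v f + v h) \<and>
     (\<forall>r f. smooth_fun A f \<longrightarrow> v (\<lambda>x. r * f x) = r * v f) \<and>
     (\<forall>f h. smooth_fun A f \<and> smooth_fun A h \<longrightarrow> v (\<lambda>x. f x * h x) = f p * v h + h p * v f)}"

definition vector_field :: "('a, 'n::finite) chart set \<Rightarrow> 'a vfield \<Rightarrow> bool" where
  "vector_field A X \<longleftrightarrow>
     (\<forall>p. X p \<in> tangent_space A p) \<and>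
     (\<forall>f. smooth_fun A f \<longrightarrow> smooth_fun A (\<lambda>p. X p f))"

definition lie_bracket :: "'a vfield \<Rightarrow> 'a vfield \<Rightarrow> 'a vfield" where
  "lie_bracket X Y = (\<lambda>p f. X p (\<lambda>q. Y q f) - Y p (\<lambda>q. X q f))"

section \<open>Metrics and connections\<close>

definition pseudo_riemannian_metric ::
  "('a, 'n::finite) chart set \<Rightarrow> ('a \<Rightarrow> 'a tvec \<Rightarrow> 'a tvec \<Rightarrow> real) \<Rightarrow> bool" where
  "pseudo_riemannian_metric A g \<longleftrightarrow>
     (\<forall>p. \<forall>u\<in>tangent_space A p. \<forall>v\<in>tangent_space A p. \<forall>w\<in>tangent_space A p. \<forall>r s.
        g p (\<lambda>f. r * u f + s * v f) w = r * g p u w + s * g p v w) \<and>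
     (\<forall>p. \<forall>u\<in>tangent_space A p. \<forall>v\<in>tangent_space A p. g p u v = g p v u) \<and>
     (\<forall>p. \<forall>u\<in>tangent_space A p. (\<forall>v\<in>tangent_space A p. g p u v = 0) \<longrightarrow> u = (\<lambda>f. 0)) \<and>
     (\<forall>X Y. vector_field A X \<and> vector_field A Y \<longrightarrow> smooth_fun A (\<lambda>p. g p (X p) (Y p)))"

definition affine_connection :: "('a, 'n::finite) chart set \<Rightarrow> 'a connection \<Rightarrow> bool" where
  "affine_connection A D \<longleftrightarrow>
     (\<forall>X Y. vector_field A X \<and> vector_field A Y \<longrightarrow> vector_field A (D X Y)) \<and>
     (\<forall>X X' Y. vector_field A X \<and> vector_field A X' \<and> vector_field A Y \<longrightarrow>
        D (\<lambda>p f. X p f + X' p f) Y = (\<lambda>p f. D X Y p f + D X' Y p f)) \<and>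
     (\<forall>h X Y. smooth_fun A h \<and> vector_field A X \<and> vector_field A Y \<longrightarrow>
        D (\<lambda>p f. h p * X p f) Y = (\<lambda>p f. h p * D X Y p f)) \<and>
     (\<forall>X Y Y'. vector_field A X \<and> vector_field A Y \<and> vector_field A Y' \<longrightarrow>
        D X (\<lambda>p f. Y p f + Y' p f) = (\<lambda>p f. D X Y p f + D X Y' p f)) \<and>
     (\<forall>h X Y. smooth_fun A h \<and> vector_field A X \<and> vector_field A Y \<longrightarrow>
        D X (\<lambda>p f. h p * Y p f) = (\<lambda>p f. X p h * Y p f + h p * D X Y p f))"

definition dual_connections ::
  "('a, 'n::finite) chart set \<Rightarrow> ('a \<Rightarrow> 'a tvec \<Rightarrow> 'a tvec \<Rightarrow> real) \<Rightarrow>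
     'a connection \<Rightarrow> 'a connection \<Rightarrow> bool" where
  "dual_connections A g D D' \<longleftrightarrow>
     (\<forall>X Y Z. vector_field A X \<and> vector_field A Y \<and> vector_field A Z \<longrightarrow>
        (\<forall>p. X p (\<lambda>q. g q (Y q) (Z q)) = g p (D X Y p) (Z p) + g p (Y p) (D' X Z p)))"

definition alpha_connection :: "real \<Rightarrow> 'a connection \<Rightarrow> 'a connection \<Rightarrow> 'a connection" where
  "alpha_connection \<alpha> D D' X Y =
     (\<lambda>p f. (1 + \<alpha>) / 2 * D X Y p f + (1 - \<alpha>) / 2 * D' X Y p f)"

definition difference_tensor :: "'a connection \<Rightarrow> 'a connection \<Rightarrow> 'a connection" where
  "difference_tensor D D' X Y = (\<lambda>p f. D' X Y p f - D X Y p f)"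

definition curvature ::
  "'a connection \<Rightarrow> 'a vfield \<Rightarrow> 'a vfield \<Rightarrow> 'a vfield \<Rightarrow> 'a vfield" where
  "curvature D X Y Z =
     (\<lambda>p f. D X (D Y Z) p f - D Y (D X Z) p f - D (lie_bracket X Y) Z p f)"

section \<open>Components in local coordinates\<close>

text \<open>The tangent vector \<open>\<partial>\<^sub>i\<close> at \<open>p\<close>, for a chart \<open>c\<close> around \<open>p\<close>.\<close>

definition coord_vec ::
  "('a, 'n::finite) chart set \<Rightarrow> ('a, 'n) chart \<Rightarrow> 'n \<Rightarrow> 'a \<Rightarrow> 'a tvec" where
  "coord_vec A c i p = (\<lambda>f. if smooth_fun A f
     then frechet_derivative (f \<circ> chart_inv c) (at (snd c p)) (axis i 1) else 0)"

text \<open>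
  Connections act on vector fields on the whole manifold, whereas \<open>\<partial>\<^sub>i\<close> lives on the domain of the
  chart only. So at \<open>p\<close> we use a global vector field that coincides with \<open>\<partial>\<^sub>i\<close> near \<open>p\<close>; one exists
  thanks to smooth bump functions, and connections being local, values at \<open>p\<close> do not depend on it.
\<close>

definition coord_field ::
  "('a::topological_space, 'n::finite) chart set \<Rightarrow> ('a, 'n) chart \<Rightarrow> 'a \<Rightarrow> 'n \<Rightarrow> 'a vfield" where
  "coord_field A c p i = (SOME X. vector_field A X \<and>
     (\<exists>V. open V \<and> p \<in> V \<and> V \<subseteq> fst c \<and> (\<forall>q\<in>V. X q = coord_vec A c i q)))"

text \<open>The coefficient of \<open>\<partial>\<^sub>j\<close> in the expansion of a tangent vector \<open>v\<close> at \<open>p\<close>.\<close>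

definition vec_comp ::
  "('a, 'n::finite) chart set \<Rightarrow> ('a, 'n) chart \<Rightarrow> 'a \<Rightarrow> 'a tvec \<Rightarrow> 'n \<Rightarrow> real" where
  "vec_comp A c p v j =
     (THE a :: real ^ 'n. v = (\<lambda>f. \<Sum>k\<in>UNIV. a $ k * coord_vec A c k p f)) $ j"

definition metric_comp ::
  "('a, 'n::finite) chart set \<Rightarrow> ('a \<Rightarrow> 'a tvec \<Rightarrow> 'a tvec \<Rightarrow> real) \<Rightarrow> ('a, 'n) chart \<Rightarrow> 'a \<Rightarrow>
     'n \<Rightarrow> 'n \<Rightarrow> real" where
  "metric_comp A g c p i j = g p (coord_vec A c i p) (coord_vec A c j p)"

definition inv_metric_comp ::
  "('a, 'n::finite) chart set \<Rightarrow> ('a \<Rightarrow> 'a tvec \<Rightarrow> 'a tvec \<Rightarrow> real) \<Rightarrow> ('a, 'n) chart \<Rightarrow> 'a \<Rightarrow>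
     'n \<Rightarrow> 'n \<Rightarrow> real" where
  "inv_metric_comp A g c p i j = matrix_inv (\<chi> k l. metric_comp A g c p k l) $ i $ j"

text \<open>\<open>diff_comp A c D D' p m i l\<close> is \<open>K\<^sup>m\<^sub>i\<^sub>l\<close>, where \<open>K(\<partial>\<^sub>i, \<partial>\<^sub>l) = K\<^sup>m\<^sub>i\<^sub>l \<partial>\<^sub>m\<close>.\<close>

definition diff_comp ::
  "('a::topological_space, 'n::finite) chart set \<Rightarrow> ('a, 'n) chart \<Rightarrow>
     'a connection \<Rightarrow> 'a connection \<Rightarrow> 'a \<Rightarrow> 'n \<Rightarrow> 'n \<Rightarrow> 'n \<Rightarrow> real" where
  "diff_comp A c D D' p m i l =
     vec_comp A c p (difference_tensor D D' (coord_field A c p i) (coord_field A c p l) p) m"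

text \<open>
  \<open>curv_comp A c D p i j k l\<close> is the component with lower indices \<open>i\<close>, \<open>k\<close>, \<open>l\<close> and upper index \<open>j\<close>,
  where \<open>R(\<partial>\<^sub>k, \<partial>\<^sub>l) \<partial>\<^sub>i\<close> is the sum over \<open>j\<close> of these components times \<open>\<partial>\<^sub>j\<close>.
\<close>

definition curv_comp ::
  "('a::topological_space, 'n::finite) chart set \<Rightarrow> ('a, 'n) chart \<Rightarrow>
     'a connection \<Rightarrow> 'a \<Rightarrow> 'n \<Rightarrow> 'n \<Rightarrow> 'n \<Rightarrow> 'n \<Rightarrow> real" where
  "curv_comp A c D p i j k l =
     vec_comp A c p
       (curvature D (coord_field A c p k) (coord_field A c p l) (coord_field A c p i) p) j"

definition ricci ::
  "('a::topological_space, 'n::finite) chart set \<Rightarrow> ('a, 'n) chart \<Rightarrow>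
     'a connection \<Rightarrow> 'a \<Rightarrow> 'n \<Rightarrow> 'n \<Rightarrow> real" where
  "ricci A c D p l j = (\<Sum>i\<in>UNIV. curv_comp A c D p l i i j)"

definition diff_ricci ::
  "('a::topological_space, 'n::finite) chart set \<Rightarrow> ('a, 'n) chart \<Rightarrow>
     'a connection \<Rightarrow> 'a connection \<Rightarrow> 'a \<Rightarrow> 'n \<Rightarrow> 'n \<Rightarrow> real" where
  "diff_ricci A c D D' p l j = (let K = diff_comp A c D D' p in
     (\<Sum>i\<in>UNIV. \<Sum>m\<in>UNIV. K m i l * K i j m - K i i m * K m j l))"

text \<open>
  For the components \<open>T\<close> of a covariant 2-tensor at \<open>p\<close>: its symmetric part minus half its
  \<open>g\<close>-trace times \<open>g\<close>.
\<close>

definition trace_adjusted ::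
  "('a, 'n::finite) chart set \<Rightarrow> ('a \<Rightarrow> 'a tvec \<Rightarrow> 'a tvec \<Rightarrow> real) \<Rightarrow> ('a, 'n) chart \<Rightarrow> 'a \<Rightarrow>
     ('n \<Rightarrow> 'n \<Rightarrow> real) \<Rightarrow> 'n \<Rightarrow> 'n \<Rightarrow> real" where
  "trace_adjusted A g c p T i j = (T i j + T j i) / 2 -
     1 / 2 * metric_comp A g c p i j * (\<Sum>l\<in>UNIV. \<Sum>k\<in>UNIV. inv_metric_comp A g c p l k * T l k)"

definition einstein ::
  "('a::topological_space, 'n::finite) chart set \<Rightarrow> ('a \<Rightarrow> 'a tvec \<Rightarrow> 'a tvec \<Rightarrow> real) \<Rightarrow>
     ('a, 'n) chart \<Rightarrow> 'a connection \<Rightarrow> 'a \<Rightarrow> 'n \<Rightarrow> 'n \<Rightarrow> real" where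
  "einstein A g c D p = trace_adjusted A g c p (ricci A c D p)"

definition diff_einstein ::
  "('a::topological_space, 'n::finite) chart set \<Rightarrow> ('a \<Rightarrow> 'a tvec \<Rightarrow> 'a tvec \<Rightarrow> real) \<Rightarrow>
     ('a, 'n) chart \<Rightarrow> 'a connection \<Rightarrow> 'a connection \<Rightarrow> 'a \<Rightarrow> 'n \<Rightarrow> 'n \<Rightarrow> real" where
  "diff_einstein A g c D D' p = trace_adjusted A g c p (diff_ricci A c D D' p)"

end

theory Submission
  imports Defs
begin

text \<open>
  With \<open>a = (1 + \<alpha>) / 2\<close> and \<open>b = (1 - \<alpha>) / 2\<close> we have \<open>a + b = 1\<close>, and the \<open>\<alpha>\<close>-connection is
  \<open>a \<nabla> + b \<nabla>*\<close>. Its curvature is quadratic in the connection: expanding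
  \<open>(a \<nabla>\<^sub>X + b \<nabla>*\<^sub>X) (a \<nabla>\<^sub>Y + b \<nabla>*\<^sub>Y)\<close> and using \<open>a\<^sup>2 = a - a b\<close> and \<open>b\<^sup>2 = b - a b\<close>, the
  deviation from the affine combination \<open>a R + b R*\<close> is \<open>- a b\<close> times the commutator of
  \<open>K(X, -)\<close> and \<open>K(Y, -)\<close>, where \<open>K = \<nabla>* - \<nabla>\<close>; the bracket term is affine in the connection
  and does not deviate (\<open>curvature_alpha_connection\<close>). Here
  \<open>a b = (1 - \<alpha>\<^sup>2) / 4\<close>. Contracting the commutator of \<open>K\<close> with itself gives minus the tensor
  \<open>\<K>\<^sub>l\<^sub>j\<close> (\<open>ricci_alpha_connection\<close>), and the passage from a Ricci tensor to an
  Einstein tensor, symmetrising and subtracting half of the trace times the metric, is linear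
  (\<open>trace_adjusted_lincomb\<close>).
  
  The remaining work lies in the contraction, which happens in local coordinates. The \<open>j\<close>-th component
  of \<open>K(\<partial>\<^sub>k, K(\<partial>\<^sub>l, \<partial>\<^sub>i))\<close> is the sum over \<open>m\<close> of \<open>K\<^sup>j\<^sub>k\<^sub>m K\<^sup>m\<^sub>l\<^sub>i\<close> only because \<open>K\<close>,
  defined on global vector fields, is tensorial: its value at a point is determined by the
  components of its second argument there (\<open>function_linear_expansion\<close>). To speak of components
  one needs that the \<open>\<partial>\<^sub>i\<close> form a basis of the space of derivations
  (\<open>tangent_vector_expansion\<close>), which rests on Hadamard's expansion of a smooth function, and
  one needs global vector fields and functions that coincide near a point with the \<open>\<partial>\<^sub>i\<close> and the
  coordinates, which rests on bump functions (\<open>smooth_cutoff\<close>).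
\<close>

section \<open>Calculus of smooth functions\<close>

lemma Ck_on_cong:
  assumes "open S" and "\<And>x. x \<in> S \<Longrightarrow> f x = g x" and "Ck_on k f S"
  shows "Ck_on k g S"
  using assms(2,3)
proof (induction k arbitrary: f g)
  case 0
  then show ?case by (simp cong: continuous_on_cong)
next
  case (Suc k)
  have der: "(g has_derivative frechet_derivative f (at x)) (at x)" if "x \<in> S" for x
    using Suc.prems that assms(1)
    by (intro has_derivative_transform_within_open[of f _ x UNIV S g])
       (auto simp: frechet_derivative_works)
  have eq: "frechet_derivative f (at x) = frechet_derivative g (at x)" if "x \<in> S" for x
    using frechet_derivative_at[OF der[OF that]] .
  show ?case
    using der Suc.prems Suc.IH[of "\<lambda>x. frechet_derivative f (at x) _"] eq
    by (auto simp: differentiable_def)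
qed

text \<open>
  The recursion defining \<open>Ck_on\<close> speaks of the chosen Frechet derivative; this rule lets one
  supply an explicit formula for the derivative instead. It starts most of the inductions
  on the order of differentiability below.
\<close>

lemma Ck_on_SucI:
  assumes "open S" and der: "\<And>x. x \<in> S \<Longrightarrow> (f has_derivative f' x) (at x)"
    and "\<And>v. Ck_on k (\<lambda>x. f' x v) S"
  shows "Ck_on (Suc k) f S"
proof -
  have "f' x = frechet_derivative f (at x)" if "x \<in> S" for x
    using frechet_derivative_at[OF der[OF that]] .
  then have "Ck_on k (\<lambda>x. frechet_derivative f (at x) v) S" for v
    by (intro Ck_on_cong[OF assms(1) _ assms(3)]) simp
  moreover have "f differentiable (at x)" if "x \<in> S" for x
    using der[OF that] unfolding differentiable_def by blast
  ultimately show ?thesis by simp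
qed

lemma Ck_on_Suc_derivative:
  assumes "Ck_on (Suc k) f S" and "x \<in> S"
  shows "(f has_derivative frechet_derivative f (at x)) (at x)"
proof -
  have "f differentiable (at x)" using assms by simp
  then show ?thesis unfolding frechet_derivative_works .
qed

lemma Ck_on_lower: "Ck_on (Suc k) f S \<Longrightarrow> Ck_on k f S"
proof (induction k arbitrary: f)
  case 0
  then show ?case
    by (auto intro!: continuous_at_imp_continuous_on differentiable_imp_continuous_within)
next
  case (Suc k)
  then show ?case by (metis Ck_on.simps(2))
qed

lemma Ck_on_local:
  assumes "\<And>x. x \<in> S \<Longrightarrow> \<exists>T. open T \<and> x \<in> T \<and> Ck_on k f T"
  shows "Ck_on k f S"
  using assms
proof (induction k arbitrary: f)
  case 0
  then show ?case
    by (metis Ck_on.simps(1) continuous_at_imp_continuous_on continuous_on_eq_continuous_at)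
next
  case (Suc k)
  then show ?case by (metis Ck_on.simps(2))
qed

lemma Ck_on_subset:
  assumes "Ck_on k f S" and "T \<subseteq> S"
  shows "Ck_on k f T"
  using assms(1)
proof (induction k arbitrary: f)
  case 0
  then show ?case using assms(2) continuous_on_subset by auto
next
  case (Suc k)
  then show ?case using assms(2) by auto
qed

lemma Ck_on_const: "open S \<Longrightarrow> Ck_on k (\<lambda>x. c) S"
proof (induction k arbitrary: c)
  case (Suc k)
  then show ?case by (intro Ck_on_SucI[where f' = "\<lambda>_ _. 0"]) (auto intro: Suc.IH)
qed auto

lemma Ck_on_bounded_linear:
  assumes "bounded_linear L" "open S" "Ck_on k f S"
  shows "Ck_on k (\<lambda>x. L (f x)) S"
  using assms(3)
proof (induction k arbitrary: f)
  case 0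
  then show ?case using assms by (auto intro: bounded_linear.continuous_on)
next
  case (Suc k)
  show ?case
    using Suc.prems
    by (intro Ck_on_SucI[where f' = "\<lambda>x v. L (frechet_derivative f (at x) v)"])
       (auto intro!: Suc.IH bounded_linear.has_derivative[OF assms(1)] assms(2)
         simp: frechet_derivative_works)
qed

lemma Ck_on_ident: "open S \<Longrightarrow> Ck_on k (\<lambda>x. x) S"
proof (cases k)
  case (Suc m)
  assume "open S"
  then show ?thesis unfolding Suc
    by (intro Ck_on_SucI[where f' = "\<lambda>_ v. v"]) (auto intro: Ck_on_const)
qed auto

lemma Ck_on_add:
  assumes "open S" "Ck_on k f S" "Ck_on k g S"
  shows "Ck_on k (\<lambda>x. f x + g x) S"
  using assms(2,3)
proof (induction k arbitrary: f g)
  case 0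
  then show ?case by (auto intro: continuous_on_add)
next
  case (Suc k)
  show ?case
    using Suc.prems
    by (intro Ck_on_SucI[where f' =
          "\<lambda>x v. frechet_derivative f (at x) v + frechet_derivative g (at x) v"])
       (auto intro!: Suc.IH has_derivative_add assms(1) simp: frechet_derivative_works)
qed

text \<open>
  By the product rule the derivative is a sum of products of factors that are again one order
  less differentiable, which is why the induction hypothesis has to range over all pairs.
\<close>

lemma Ck_on_bilinear:
  assumes "bounded_bilinear P" "open S" "Ck_on k f S" "Ck_on k g S"
  shows "Ck_on k (\<lambda>x. P (f x) (g x)) S"
  using assms(3,4)
proof (induction k arbitrary: f g)
  case 0
  then show ?case using bounded_bilinear.continuous_on[OF assms(1)] by auto
next
  case (Suc k)
  note low = Suc.prems[THEN Ck_on_lower]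
  show ?case
    using Suc.prems low
    by (intro Ck_on_SucI[where f' = "\<lambda>x v. P (f x) (frechet_derivative g (at x) v)
          + P (frechet_derivative f (at x) v) (g x)"])
       (auto intro!: Ck_on_add Suc.IH bounded_bilinear.FDERIV[OF assms(1)] assms(2)
         simp: frechet_derivative_works)
qed

lemma Ck_on_sum:
  assumes "open S" "\<And>i. i \<in> I \<Longrightarrow> Ck_on k (f i) S"
  shows "Ck_on k (\<lambda>x. \<Sum>i\<in>I. f i x) S"
  using assms(2)
  by (induction I rule: infinite_finite_induct) (simp_all add: Ck_on_const Ck_on_add assms(1))

text \<open>
  The derivative of \<open>f \<circ> g\<close> in a direction \<open>v\<close> is not of the form \<open>h \<circ> g\<close>, as the direction
  \<open>g' x v\<close> varies with the point. Expanding this direction in the finite basis turns the chain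
  rule into a sum of products of \<open>C\<^sup>k\<close> functions with compositions to which the induction
  hypothesis applies.
\<close>

lemma Ck_on_compose:
  fixes f :: "'b::euclidean_space \<Rightarrow> 'c::real_normed_vector"
  assumes "open S" "open T" "Ck_on k f T" "Ck_on k g S" "g ` S \<subseteq> T"
  shows "Ck_on k (\<lambda>x. f (g x)) S"
  using assms(3,4)
proof (induction k arbitrary: f)
  case 0
  then show ?case using assms(5) by (auto intro: continuous_on_compose2)
next
  case (Suc k)
  let ?f' = "\<lambda>y. frechet_derivative f (at y)" and ?g' = "\<lambda>x. frechet_derivative g (at x)"
  have der: "((\<lambda>x. f (g x)) has_derivative
      (\<lambda>v. \<Sum>b\<in>Basis. (?g' x v \<bullet> b) *\<^sub>R ?f' (g x) b)) (at x)" if "x \<in> S" for x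
  proof -
    have f': "(f has_derivative ?f' (g x)) (at (g x))"
      and g': "(g has_derivative ?g' x) (at x)"
      using that assms(5) Ck_on_Suc_derivative[OF Suc.prems(1)] Ck_on_Suc_derivative[OF Suc.prems(2)]
      by auto
    interpret f': linear "?f' (g x)" using f' by (rule has_derivative_linear)
    have "?f' (g x) w = (\<Sum>b\<in>Basis. (w \<bullet> b) *\<^sub>R ?f' (g x) b)" for w
    proof -
      have "?f' (g x) w = ?f' (g x) (\<Sum>b\<in>Basis. (w \<bullet> b) *\<^sub>R b)"
        by (simp only: euclidean_representation)
      also have "\<dots> = (\<Sum>b\<in>Basis. (w \<bullet> b) *\<^sub>R ?f' (g x) b)"
        by (simp only: f'.sum f'.scale)
      finally show ?thesis .
    qed
    then show ?thesis
      by (intro has_derivative_eq_rhs[OF has_derivative_compose[OF g' f']] ext)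
  qed
  show ?case
  proof (rule Ck_on_SucI[OF assms(1) der])
    fix v
    have "Ck_on k (\<lambda>x. ?g' x v) S" "\<And>w. Ck_on k (\<lambda>y. ?f' y w) T"
      using Suc.prems by simp_all
    note g'_v = this(1) and f'_w = this(2)
    have "Ck_on k (\<lambda>x. ?g' x v \<bullet> b) S" for b
      by (rule Ck_on_bounded_linear[OF bounded_linear_inner_left assms(1) g'_v])
    moreover have "Ck_on k (\<lambda>x. ?f' (g x) b) S" for b
      by (rule Suc.IH[OF f'_w Ck_on_lower[OF Suc.prems(2)]])
    ultimately show "Ck_on k (\<lambda>x. \<Sum>b\<in>Basis. (?g' x v \<bullet> b) *\<^sub>R ?f' (g x) b) S"
      using assms(1) by (intro Ck_on_sum Ck_on_bilinear[OF bounded_bilinear_scaleR])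
  qed
qed

lemma smooth_on_cong:
  assumes "open S" "\<And>x. x \<in> S \<Longrightarrow> f x = g x" "smooth_on S f"
  shows "smooth_on S g"
  unfolding smooth_on_def
proof
  show "Ck_on k g S" for k
    by (rule Ck_on_cong[OF assms(1,2)]) (use assms(3) in \<open>auto simp: smooth_on_def\<close>)
qed

lemma smooth_on_local:
  assumes "\<And>x. x \<in> S \<Longrightarrow> \<exists>T. open T \<and> x \<in> T \<and> smooth_on T f"
  shows "smooth_on S f"
  unfolding smooth_on_def
proof
  fix k
  have "\<exists>T. open T \<and> x \<in> T \<and> Ck_on k f T" if "x \<in> S" for x
    using assms[OF that] unfolding smooth_on_def by auto
  then show "Ck_on k f S" by (rule Ck_on_local)
qed

lemma smooth_on_subset: "smooth_on S f \<Longrightarrow> T \<subseteq> S \<Longrightarrow> smooth_on T f"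
  by (auto simp: smooth_on_def intro: Ck_on_subset)

lemma smooth_on_const: "open S \<Longrightarrow> smooth_on S (\<lambda>x. c)"
  by (simp add: smooth_on_def Ck_on_const)

lemma smooth_on_bounded_linear: "bounded_linear L \<Longrightarrow> open S \<Longrightarrow> smooth_on S L"
  using Ck_on_bounded_linear[OF _ _ Ck_on_ident] by (auto simp: smooth_on_def)

lemma smooth_on_add:
  "open S \<Longrightarrow> smooth_on S f \<Longrightarrow> smooth_on S g \<Longrightarrow> smooth_on S (\<lambda>x. f x + g x)"
  by (simp add: smooth_on_def Ck_on_add)

lemma smooth_on_sum:
  "open S \<Longrightarrow> (\<And>i. i \<in> I \<Longrightarrow> smooth_on S (f i)) \<Longrightarrow> smooth_on S (\<lambda>x. \<Sum>i\<in>I. f i x)"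
  by (simp add: smooth_on_def Ck_on_sum)

lemma smooth_on_bilinear:
  "bounded_bilinear P \<Longrightarrow> open S \<Longrightarrow> smooth_on S f \<Longrightarrow> smooth_on S g
    \<Longrightarrow> smooth_on S (\<lambda>x. P (f x) (g x))"
  by (simp add: smooth_on_def Ck_on_bilinear)

lemmas smooth_on_mult = smooth_on_bilinear[OF bounded_bilinear_mult]

lemma smooth_on_compose:
  fixes f :: "'b::euclidean_space \<Rightarrow> 'c::real_normed_vector"
  assumes "open S" "open T" "smooth_on T f" "smooth_on S g" "g ` S \<subseteq> T"
  shows "smooth_on S (\<lambda>x. f (g x))"
  unfolding smooth_on_def
proof
  show "Ck_on k (\<lambda>x. f (g x)) S" for k
    by (rule Ck_on_compose[OF assms(1,2) _ _ assms(5)])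
       (use assms(3,4) in \<open>simp_all add: smooth_on_def\<close>)
qed

lemma smooth_on_has_derivative:
  "smooth_on S f \<Longrightarrow> x \<in> S \<Longrightarrow> (f has_derivative frechet_derivative f (at x)) (at x)"
  using Ck_on_Suc_derivative[of 0 f S x] by (simp add: smooth_on_def del: Ck_on.simps)

lemma smooth_on_frechet_derivative:
  "smooth_on S f \<Longrightarrow> smooth_on S (\<lambda>x. frechet_derivative f (at x) v)"
  unfolding smooth_on_def
proof
  fix k
  assume "\<forall>k. Ck_on k f S"
  then have "Ck_on (Suc k) f S" ..
  then show "Ck_on k (\<lambda>x. frechet_derivative f (at x) v) S" by simp
qed

lemma smooth_on_imp_continuous_on: "smooth_on S f \<Longrightarrow> continuous_on S f"
  unfolding smooth_on_def by (drule spec[of _ 0]) simp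

section \<open>Bump functions\<close>

lemma smooth_on_inverse: "smooth_on {x::real. x \<noteq> 0} inverse"
proof -
  have op: "open {x::real. x \<noteq> 0}" by (auto intro: open_Collect_neq)
  have "Ck_on k inverse {x::real. x \<noteq> 0}" for k
  proof (induction k)
    case 0
    show ?case by (auto intro!: continuous_intros)
  next
    case (Suc k)
    show ?case
    proof (rule Ck_on_SucI[OF op])
      show "(inverse has_derivative (\<lambda>v. v * (- (inverse x * inverse x)))) (at x)"
        if "x \<in> {x::real. x \<noteq> 0}" for x
        using has_derivative_inverse'[of x UNIV] that by (simp add: algebra_simps)
      show "Ck_on k (\<lambda>x. v * (- (inverse x * inverse x))) {x::real. x \<noteq> 0}" for v
        by (intro Ck_on_bounded_linear[OF bounded_linear_mult_right]
            Ck_on_bounded_linear[OF bounded_linear_minus[OF bounded_linear_ident]]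
            Ck_on_bilinear[OF bounded_bilinear_mult] op Suc.IH)
    qed
  qed
  then show ?thesis by (simp add: smooth_on_def)
qed

text \<open>
  For \<open>n = 0\<close> this is the classical flat function \<open>exp (- 1 / t)\<close>. The family over all \<open>n\<close> is
  closed under differentiation up to linear combinations, so that smoothness of all its members
  follows by one induction.
\<close>

definition flat :: "nat \<Rightarrow> real \<Rightarrow> real" where
  "flat n t = (if t \<le> 0 then 0 else exp (- (1 / t)) / t ^ n)"

lemma flat_has_derivative:
  "(flat n has_real_derivative flat (n + 2) t - real n * flat (n + 1) t) (at t)"
proof -
  consider "t < 0" | "t = 0" | "t > 0" by linarith
  then show ?thesis
  proof cases
    case 1
    have "((\<lambda>_. 0::real) has_real_derivative 0) (at t)" by simp
    then have "(flat n has_real_derivative 0) (at t)"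
      by (rule has_field_derivative_transform_within_open[of _ _ _ "{..<0}"])
         (use 1 in \<open>auto simp: flat_def\<close>)
    then show ?thesis using 1 by (simp add: flat_def)
  next
    case 2
    have "((\<lambda>h. inverse h ^ (n + 1) / exp (inverse h)) \<longlongrightarrow> 0) (at_right (0::real))"
      by (rule filterlim_compose[OF tendsto_power_div_exp_0 filterlim_inverse_at_top_right])
    then have r: "((\<lambda>h. flat n h / h) \<longlongrightarrow> 0) (at_right 0)"
      by (rule Lim_transform_eventually)
         (auto simp: eventually_at_filter flat_def exp_minus field_simps)
    have l: "((\<lambda>h. flat n h / h) \<longlongrightarrow> 0) (at_left 0)"
      by (rule Lim_transform_eventually[OF tendsto_const])
         (auto simp: eventually_at_filter flat_def)
    have "((\<lambda>h. flat n h / h) \<longlongrightarrow> 0) (at 0)"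
      using l r by (simp add: filterlim_split_at)
    then show ?thesis using 2 by (simp add: has_field_derivative_iff flat_def)
  next
    case 3
    have "((\<lambda>t. exp (- (1 / t)) / t ^ n) has_real_derivative
        flat (n + 2) t - real n * flat (n + 1) t) (at t)"
      using 3
      by (cases n)
         (auto intro!: derivative_eq_intros simp: flat_def field_simps power2_eq_square,
           metis One_nat_def mult.commute neq0_conv power_minus_mult)
    then show ?thesis
      by (rule has_field_derivative_transform_within_open[of _ _ _ "{0<..}"])
         (use 3 in \<open>auto simp: flat_def\<close>)
  qed
qed

lemma smooth_on_flat: "smooth_on UNIV (flat n)"
proof -
  have "Ck_on k (flat n) UNIV" for k
  proof (induction k arbitrary: n)
    case 0
    show ?case
      using DERIV_isCont[OF flat_has_derivative]
      by (auto intro!: continuous_at_imp_continuous_on)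
  next
    case (Suc k)
    show ?case
    proof (rule Ck_on_SucI[OF open_UNIV])
      show "(flat n has_derivative (\<lambda>v. v * (flat (n + 2) x + (- real n) * flat (n + 1) x))) (at x)" for x
        using flat_has_derivative[of n x] by (simp add: has_field_derivative_def mult.commute[of _ "_ - _"])
      show "Ck_on k (\<lambda>x. v * (flat (n + 2) x + (- real n) * flat (n + 1) x)) UNIV" for v
        by (intro Ck_on_bounded_linear[OF bounded_linear_mult_right] Ck_on_add open_UNIV Suc.IH)
    qed
  qed
  then show ?thesis by (simp add: smooth_on_def)
qed

text \<open>
  The cutoff \<open>\<sigma>\<close> is the usual quotient that rises from 0 to 1 on the unit interval, where
  the denominator never vanishes as \<open>t\<close> and \<open>1 - t\<close> are not both nonpositive. It is composed with
  a quadratic function of the distance to \<open>x0\<close> that is at least 1 within \<open>r / 2\<close> and at most 0 beyond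
  \<open>r\<close>.
\<close>

lemma smooth_bump:
  fixes x0 :: "'v::euclidean_space"
  assumes "r > 0"
  obtains \<psi> :: "'v \<Rightarrow> real" and s where "s > 0" "smooth_on UNIV \<psi>"
    "\<And>y. y \<in> ball x0 s \<Longrightarrow> \<psi> y = 1" "\<And>y. y \<notin> cball x0 r \<Longrightarrow> \<psi> y = 0" "s \<le> r"
proof -
  define u where "u y = 2 - 2 / r\<^sup>2 * ((y - x0) \<bullet> (y - x0))" for y
  define \<sigma> where "\<sigma> t = flat 0 t * inverse (flat 0 t + flat 0 (1 - t))" for t
  have flat0: "flat 0 t \<ge> 0" "flat 0 t = 0 \<longleftrightarrow> t \<le> 0" for t by (auto simp: flat_def)
  have ne: "flat 0 t + flat 0 (1 - t) \<noteq> 0" for t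
    using flat0(1)[of t] flat0(1)[of "1 - t"] flat0(2)[of t] flat0(2)[of "1 - t"] by linarith
  have lin: "smooth_on UNIV (\<lambda>t::real. 1 + - t)"
    by (intro smooth_on_add smooth_on_const smooth_on_bounded_linear bounded_linear_minus
          bounded_linear_ident open_UNIV)
  have sm1: "smooth_on UNIV (\<lambda>t. flat 0 (1 + - t))"
    by (rule smooth_on_compose[OF _ _ smooth_on_flat lin]) auto
  have "smooth_on UNIV \<sigma>"
    unfolding \<sigma>_def using ne sm1
    by (intro smooth_on_mult smooth_on_flat open_UNIV
          smooth_on_compose[OF _ _ smooth_on_inverse smooth_on_add])
       (auto intro: open_Collect_neq smooth_on_flat)
  moreover have tr: "smooth_on UNIV (\<lambda>y. y + - x0)"
    by (intro smooth_on_add smooth_on_const smooth_on_bounded_linear bounded_linear_ident open_UNIV)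
  have "smooth_on UNIV (\<lambda>y. 2 + (- (2 / r\<^sup>2)) * ((y + - x0) \<bullet> (y + - x0)))"
    by (intro smooth_on_add smooth_on_mult smooth_on_const smooth_on_bilinear[OF bounded_bilinear_inner]
          tr open_UNIV)
  then have "smooth_on UNIV u" by (simp add: u_def[abs_def])
  ultimately have 1: "smooth_on UNIV (\<lambda>y. \<sigma> (u y))"
    by (rule smooth_on_compose[OF open_UNIV open_UNIV]) auto
  have one: "\<sigma> (u y) = 1" if "y \<in> ball x0 (r / 2)" for y
  proof -
    have "norm (y - x0) \<le> r / 2" using that by (simp add: dist_norm norm_minus_commute)
    then have "(norm (y - x0))\<^sup>2 \<le> (r / 2)\<^sup>2" by (rule power_mono) auto
    then have "4 * (norm (y - x0))\<^sup>2 \<le> r\<^sup>2" by (simp add: power_divide)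
    then have "2 * (norm (y - x0))\<^sup>2 \<le> r\<^sup>2"
      using zero_le_power2[of "norm (y - x0)"] by linarith
    then have "u y \<ge> 1"
      using assms by (simp add: u_def dot_square_norm field_simps power2_eq_square)
    then show ?thesis using ne[of "u y"] flat0(2)[of "1 - u y"] by (simp add: \<sigma>_def)
  qed
  have zero: "\<sigma> (u y) = 0" if "y \<notin> cball x0 r" for y
  proof -
    have "r \<le> norm (y - x0)" using that by (simp add: dist_norm norm_minus_commute)
    then have "r\<^sup>2 \<le> (norm (y - x0))\<^sup>2" using assms by (intro power_mono) auto
    then have "u y \<le> 0"
      using assms by (simp add: u_def dot_square_norm field_simps power2_eq_square)
    then show ?thesis by (simp add: \<sigma>_def flat_def)
  qed
  show ?thesis by (rule that[of "r / 2" "\<lambda>y. \<sigma> (u y)"]) (use assms 1 one zero in auto)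
qed

section \<open>Hadamard's expansion of a smooth function\<close>

text \<open>
  The coefficients in Hadamard's expansion are the ray integrals of the partial derivatives with
  \<open>m = 0\<close>. Higher powers of \<open>t\<close> are included
  because each differentiation in \<open>y\<close> produces a further factor \<open>t\<close>.
\<close>

definition ray_integral :: "nat \<Rightarrow> ('v::euclidean_space \<Rightarrow> real) \<Rightarrow> 'v \<Rightarrow> 'v \<Rightarrow> real" where
  "ray_integral m F a y = integral {0..1} (\<lambda>t. t ^ m * F (a + t *\<^sub>R (y - a)))"

lemma ray_in_ball:
  fixes a :: "'v::euclidean_space"
  assumes "y \<in> ball a r" "0 \<le> t" "t \<le> 1"
  shows "a + t *\<^sub>R (y - a) \<in> ball a r"
proof -
  have "t * norm (y - a) \<le> 1 * norm (y - a)" using assms by (intro mult_right_mono) auto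
  then show ?thesis using assms by (simp add: dist_norm norm_minus_commute)
qed

lemma continuous_on_ray:
  fixes F :: "'v::euclidean_space \<Rightarrow> real"
  assumes "continuous_on (ball a r) F"
  shows "continuous_on (ball a r \<times> {0..1}) (\<lambda>(y, t). F (a + t *\<^sub>R (y - a)))"
  unfolding split_beta
  by (rule continuous_on_compose2[OF assms]) (auto intro!: continuous_intros ray_in_ball simp del: mem_ball)

lemma continuous_on_ray_section:
  fixes F :: "'v::euclidean_space \<Rightarrow> real"
  assumes "continuous_on (ball a r) F" "y \<in> ball a r"
  shows "continuous_on {0..1} (\<lambda>t. F (a + t *\<^sub>R (y - a)))"
  by (rule continuous_on_compose2[OF assms(1)])
     (use assms(2) in \<open>auto intro!: continuous_intros ray_in_ball simp del: mem_ball\<close>)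

text \<open>
  Differentiation under the integral sign: the derivative of \<open>F (a + t (y - a))\<close> in \<open>y\<close> is
  \<open>t\<close> times the derivative of \<open>F\<close>.
\<close>

lemma ray_integral_has_derivative:
  fixes F :: "'v::euclidean_space \<Rightarrow> real"
  assumes F: "smooth_on (ball a r) F" and y: "y \<in> ball a r"
  shows "(ray_integral m F a has_derivative
    (\<lambda>v. ray_integral (Suc m) (\<lambda>z. frechet_derivative F (at z) v) a y)) (at y)"
proof -
  let ?F' = "\<lambda>z. frechet_derivative F (at z)"
  let ?p = "\<lambda>t z. a + t *\<^sub>R (z - a)"
  have F': "(F has_derivative ?F' z) (at z)" if "z \<in> ball a r" for z
    using smooth_on_has_derivative[OF F that] .
  define fx where "fx z t = Blinfun (\<lambda>v. t ^ Suc m * ?F' (?p t z) v)" for z t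
  have fx: "blinfun_apply (fx z t) = (\<lambda>v. t ^ Suc m * ?F' (?p t z) v)"
    if "z \<in> ball a r" "t \<in> {0..1}" for z t
    unfolding fx_def using has_derivative_bounded_linear[OF F'[OF ray_in_ball[OF that(1)]], of t] that(2)
    by (intro bounded_linear_Blinfun_apply bounded_linear_const_mult) auto
  have cF': "continuous_on (ball a r) (\<lambda>z. ?F' z v)" for v
    by (intro smooth_on_imp_continuous_on smooth_on_frechet_derivative F)
  have cont_fx: "continuous_on (ball a r \<times> cbox 0 1) (\<lambda>(z, t). fx z t)"
  proof (rule continuous_on_blinfun_componentwise)
    fix i :: 'v
    have "continuous_on (ball a r \<times> {0..1}) (\<lambda>q. snd q ^ Suc m * (case q of (z, t) \<Rightarrow> ?F' (?p t z) i))"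
      by (intro continuous_on_mult continuous_on_ray[OF cF'] continuous_intros)
    then show "continuous_on (ball a r \<times> cbox 0 1) (\<lambda>x. blinfun_apply (case x of (z, t) \<Rightarrow> fx z t) i)"
      unfolding cbox_interval by (rule continuous_on_eq) (auto simp: fx simp del: mem_ball)
  qed
  have der: "((\<lambda>z. t ^ m * F (?p t z)) has_derivative blinfun_apply (fx z t)) (at z within ball a r)"
    if z: "z \<in> ball a r" and t: "t \<in> cbox 0 1" for z and t :: real
  proof -
    have "?p t z \<in> ball a r" using ray_in_ball z t by auto
    note d = F'[OF this]
    have p: "((\<lambda>z. ?p t z) has_derivative (\<lambda>v. t *\<^sub>R v)) (at z within ball a r)"
      by (auto intro!: derivative_eq_intros)
    have "((\<lambda>z. F (?p t z)) has_derivative (\<lambda>v. ?F' (?p t z) (t *\<^sub>R v))) (at z within ball a r)"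
      using has_derivative_compose[OF p d] .
    then have "((\<lambda>z. t ^ m * F (?p t z)) has_derivative (\<lambda>v. t ^ m * ?F' (?p t z) (t *\<^sub>R v)))
        (at z within ball a r)"
      by (rule has_derivative_mult_right)
    moreover have "(\<lambda>v. t ^ m * ?F' (?p t z) (t *\<^sub>R v)) = blinfun_apply (fx z t)"
      using z t linear_cmul[OF has_derivative_linear[OF d]] by (auto simp: fx simp del: mem_ball)
    ultimately show ?thesis by simp
  qed
  have "((\<lambda>z. integral (cbox 0 1) (\<lambda>t. t ^ m * F (?p t z))) has_derivative
      blinfun_apply (integral (cbox 0 1) (fx y))) (at y within ball a r)"
  proof (rule leibniz_rule[OF der _ cont_fx y convex_ball])
    fix z assume "z \<in> ball a r"
    then show "(\<lambda>t. t ^ m * F (?p t z)) integrable_on cbox 0 1"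
      using continuous_on_ray_section[OF smooth_on_imp_continuous_on[OF F]]
      by (intro integrable_continuous continuous_on_mult) (auto intro!: continuous_intros)
  qed
  moreover have "blinfun_apply (integral (cbox 0 1) (fx y))
      = (\<lambda>v. ray_integral (Suc m) (\<lambda>z. ?F' z v) a y)"
  proof
    fix v
    have "continuous_on (cbox 0 1) (\<lambda>t. (y, t :: real))"
      by (intro continuous_on_Pair continuous_on_const continuous_on_id)
    moreover have "(\<lambda>t. (y, t)) ` cbox 0 1 \<subseteq> ball a r \<times> cbox 0 1" using y by auto
    ultimately have "continuous_on (cbox 0 1) (fx y)"
      using continuous_on_compose2[OF cont_fx] by fastforce
    then have "fx y integrable_on cbox 0 1" by (rule integrable_continuous)
    then have "blinfun_apply (integral (cbox 0 1) (fx y)) v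
        = integral (cbox 0 1) (\<lambda>t. blinfun_apply (fx y t) v)"
      by (rule blinfun_apply_integral)
    also have "\<dots> = ray_integral (Suc m) (\<lambda>z. ?F' z v) a y"
      using y by (auto simp: ray_integral_def fx intro!: integral_cong simp del: mem_ball)
    finally show "blinfun_apply (integral (cbox 0 1) (fx y)) v
        = ray_integral (Suc m) (\<lambda>z. ?F' z v) a y" .
  qed
  ultimately show ?thesis
    using y by (simp add: ray_integral_def[abs_def] at_within_open[of y "ball a r"])
qed

text \<open>
  The derivative of a ray integral is a ray integral of a derivative, so the induction on the order of
  differentiability runs over all integrands and exponents at once.
\<close>

lemma smooth_on_ray_integral:
  fixes F :: "'v::euclidean_space \<Rightarrow> real"
  assumes "smooth_on (ball a r) F"
  shows "smooth_on (ball a r) (ray_integral m F a)"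
proof -
  have "Ck_on k (ray_integral m F a) (ball a r)" for k
    using assms
  proof (induction k arbitrary: m F)
    case 0
    show ?case
      using has_derivative_continuous[OF ray_integral_has_derivative[OF 0]]
      by (auto intro!: continuous_at_imp_continuous_on)
  next
    case (Suc k)
    show ?case
      by (rule Ck_on_SucI[OF open_ball ray_integral_has_derivative[OF Suc.prems]])
         (auto intro!: Suc.IH smooth_on_frechet_derivative Suc.prems)
  qed
  then show ?thesis by (simp add: smooth_on_def)
qed

text \<open>
  The fundamental theorem of calculus along the segment from \<open>a\<close> to \<open>y\<close>, with the directional
  derivative \<open>F' (y - a)\<close> expanded in the standard basis. What matters later is that the \<open>G i\<close> are
  smooth, so that a derivation can be applied to the products.
\<close>

lemma hadamard_expansion:
  fixes F :: "real ^ 'n::finite \<Rightarrow> real"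
  assumes F: "smooth_on (ball a r) F"
  obtains G where "\<And>i. smooth_on (ball a r) (G i)"
    "\<And>y. y \<in> ball a r \<Longrightarrow> F y = F a + (\<Sum>i\<in>UNIV. (y $ i - a $ i) * G i y)"
    "\<And>i. G i a = frechet_derivative F (at a) (axis i 1)"
proof
  let ?F' = "\<lambda>z. frechet_derivative F (at z)"
  define G where "G i = ray_integral 0 (\<lambda>z. ?F' z (axis i 1)) a" for i
  show "smooth_on (ball a r) (G i)" for i
    unfolding G_def by (intro smooth_on_ray_integral smooth_on_frechet_derivative F)
  show "G i a = ?F' a (axis i 1)" for i
    by (simp add: G_def ray_integral_def)
  fix y assume y: "y \<in> ball a r"
  have cF': "continuous_on (ball a r) (\<lambda>z. ?F' z v)" for v
    by (intro smooth_on_imp_continuous_on smooth_on_frechet_derivative F)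
  have "((\<lambda>t. ?F' (a + t *\<^sub>R (y - a)) (y - a)) has_integral
      F (a + 1 *\<^sub>R (y - a)) - F (a + 0 *\<^sub>R (y - a))) {0..1}"
  proof (rule fundamental_theorem_of_calculus)
    fix t :: real assume t: "t \<in> {0..1}"
    have d: "(F has_derivative ?F' (a + t *\<^sub>R (y - a))) (at (a + t *\<^sub>R (y - a)))"
      using t by (intro smooth_on_has_derivative[OF F] ray_in_ball[OF y]) auto
    have p: "((\<lambda>t. a + t *\<^sub>R (y - a)) has_derivative (\<lambda>h. h *\<^sub>R (y - a))) (at t within {0..1})"
      by (auto intro!: derivative_eq_intros)
    show "((\<lambda>t. F (a + t *\<^sub>R (y - a))) has_vector_derivative ?F' (a + t *\<^sub>R (y - a)) (y - a))
        (at t within {0..1})"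
      using has_derivative_compose[OF p d] linear_cmul[OF has_derivative_linear[OF d]]
      by (simp add: has_vector_derivative_def)
  qed simp
  then have "F y - F a = integral {0..1} (\<lambda>t. ?F' (a + t *\<^sub>R (y - a)) (y - a))"
    by (simp add: integral_unique)
  also have "\<dots> = integral {0..1} (\<lambda>t. \<Sum>i\<in>UNIV. (y $ i - a $ i) * ?F' (a + t *\<^sub>R (y - a)) (axis i 1))"
  proof (rule integral_cong)
    fix t :: real assume t: "t \<in> {0..1}"
    have d: "(F has_derivative ?F' (a + t *\<^sub>R (y - a))) (at (a + t *\<^sub>R (y - a)))"
      using t by (intro smooth_on_has_derivative[OF F] ray_in_ball[OF y]) auto
    interpret F': linear "?F' (a + t *\<^sub>R (y - a))" using d by (rule has_derivative_linear)
    have "?F' (a + t *\<^sub>R (y - a)) (y - a)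
        = ?F' (a + t *\<^sub>R (y - a)) (\<Sum>i\<in>UNIV. (y - a) $ i *s axis i 1)"
      by (simp only: basis_expansion)
    also have "\<dots> = (\<Sum>i\<in>UNIV. (y $ i - a $ i) * ?F' (a + t *\<^sub>R (y - a)) (axis i 1))"
      by (simp add: F'.sum F'.scale scalar_mult_eq_scaleR)
    finally show "?F' (a + t *\<^sub>R (y - a)) (y - a)
        = (\<Sum>i\<in>UNIV. (y $ i - a $ i) * ?F' (a + t *\<^sub>R (y - a)) (axis i 1))" .
  qed
  also have "\<dots> = (\<Sum>i\<in>UNIV. (y $ i - a $ i) * G i y)"
    using continuous_on_ray_section[OF cF' y]
    by (subst integral_sum)
       (auto simp: G_def ray_integral_def intro!: integrable_continuous_real continuous_intros)
  finally show "F y = F a + (\<Sum>i\<in>UNIV. (y $ i - a $ i) * G i y)" by simp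
qed

section \<open>Charts and smooth functions on a manifold\<close>

locale smooth_manifold =
  fixes A :: "('a::{t2_space, second_countable_topology}, 'n::finite) chart set"
  assumes smooth_structure: "smooth_structure A"
begin

lemma
  assumes "c \<in> A"
  shows open_chart_domain: "open (fst c)"
    and open_chart_image: "open (snd c ` fst c)"
    and chart_homeomorphism: "homeomorphism (fst c) (snd c ` fst c) (snd c) (chart_inv c)"
  using smooth_structure assms by (auto simp: smooth_structure_def is_chart_def)

lemma chart_inv_chart [simp]: "c \<in> A \<Longrightarrow> q \<in> fst c \<Longrightarrow> chart_inv c (snd c q) = q"
  using chart_homeomorphism homeomorphism_apply1 by blast

lemma open_chart_image_Int:
  assumes "c \<in> A" "open U"
  shows "open (snd c ` (fst c \<inter> U))"
proof -
  have "openin (top_of_set (snd c ` fst c)) (snd c ` (fst c \<inter> U))"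
    using assms
    by (intro homeomorphism_imp_open_map[OF chart_homeomorphism]) auto
  then show ?thesis using openin_open_trans open_chart_image[OF assms(1)] by blast
qed

lemma open_chart_inv_image:
  assumes "c \<in> A" "open W" "W \<subseteq> snd c ` fst c"
  shows "open (chart_inv c ` W)"
proof -
  have "openin (top_of_set (fst c)) (chart_inv c ` W)"
    using assms
    by (intro homeomorphism_imp_open_map[OF homeomorphism_symD[OF chart_homeomorphism]])
       (auto intro: open_subset)
  then show ?thesis using openin_open_trans open_chart_domain[OF assms(1)] by blast
qed

lemma smooth_transition:
  assumes "c \<in> A" "d \<in> A"
  shows "smooth_on (snd d ` (fst c \<inter> fst d)) (\<lambda>y. snd c (chart_inv d y))"
  using smooth_structure assms by (auto simp: smooth_structure_def compatible_def o_def)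

lemma smooth_funI:
  "(\<And>c. c \<in> A \<Longrightarrow> smooth_on (snd c ` fst c) (\<lambda>y. f (chart_inv c y))) \<Longrightarrow> smooth_fun A f"
  by (auto simp: smooth_fun_def o_def)

lemma smooth_fun_chart:
  "smooth_fun A f \<Longrightarrow> c \<in> A \<Longrightarrow> smooth_on (snd c ` fst c) (\<lambda>y. f (chart_inv c y))"
  by (auto simp: smooth_fun_def o_def)

lemma smooth_fun_const: "smooth_fun A (\<lambda>x. r)"
  by (intro smooth_funI smooth_on_const open_chart_image)

lemma smooth_fun_add:
  "smooth_fun A f \<Longrightarrow> smooth_fun A h \<Longrightarrow> smooth_fun A (\<lambda>x. f x + h x)"
  by (rule smooth_funI) (intro smooth_on_add open_chart_image smooth_fun_chart)

lemma smooth_fun_mult: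
  "smooth_fun A f \<Longrightarrow> smooth_fun A h \<Longrightarrow> smooth_fun A (\<lambda>x. f x * h x)"
  by (rule smooth_funI) (intro smooth_on_mult open_chart_image smooth_fun_chart)

lemma smooth_fun_sum:
  "(\<And>i. i \<in> I \<Longrightarrow> smooth_fun A (f i)) \<Longrightarrow> smooth_fun A (\<lambda>x. \<Sum>i\<in>I. f i x)"
  by (rule smooth_funI) (intro smooth_on_sum open_chart_image smooth_fun_chart)

text \<open>
  The last property makes functions given in the chart global: multiplied by \<open>\<phi>\<close> they extend by zero.
  The support \<open>K\<close> of \<open>\<phi>\<close> is compact and the manifold Hausdorff, so \<open>K\<close> is closed and the extension is
  smooth at the points outside the chart domain too.
\<close>

lemma smooth_cutoff:
  assumes c: "c \<in> A" and p: "p \<in> fst c" and U: "open U" "p \<in> U"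
  obtains \<phi> V where "smooth_fun A \<phi>" "open V" "p \<in> V" "V \<subseteq> fst c \<inter> U"
    "\<And>q. q \<in> V \<Longrightarrow> \<phi> q = (1::real)" "\<And>q. q \<notin> fst c \<inter> U \<Longrightarrow> \<phi> q = 0"
    "\<And>G. smooth_on (snd c ` (fst c \<inter> U)) G \<Longrightarrow> smooth_fun A (\<lambda>q. \<phi> q * G (snd c q))"
proof -
  let ?W = "snd c ` (fst c \<inter> U)"
  have W: "open ?W" using open_chart_image_Int[OF c U(1)] .
  then obtain r where r: "r > 0" "cball (snd c p) r \<subseteq> ?W"
    using p U(2) open_contains_cball by blast
  obtain \<psi> :: "real ^ 'n \<Rightarrow> real" and s where \<psi>: "s > 0" "smooth_on UNIV \<psi>"
    "\<And>y. y \<in> ball (snd c p) s \<Longrightarrow> \<psi> y = 1" "\<And>y. y \<notin> cball (snd c p) r \<Longrightarrow> \<psi> y = 0" "s \<le> r"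
    by (rule smooth_bump[OF r(1)]) (rule that)
  define \<phi> where "\<phi> q = (if q \<in> fst c then \<psi> (snd c q) else 0)" for q
  define V where "V = chart_inv c ` ball (snd c p) s"
  define K where "K = chart_inv c ` cball (snd c p) r"
  have sub: "ball (snd c p) s \<subseteq> ?W"
    using r(2) \<psi>(5) ball_subset_cball subset_ball by blast
  have V: "open V"
    unfolding V_def using sub by (intro open_chart_inv_image c) auto
  have "p \<in> V" unfolding V_def using c p \<psi>(1) by (intro image_eqI[of _ _ "snd c p"]) auto
  have VU: "V \<subseteq> fst c \<inter> U"
  proof
    fix q assume "q \<in> V"
    then obtain y where y: "y \<in> ball (snd c p) s" "q = chart_inv c y"
      unfolding V_def by blast
    then obtain x where "x \<in> fst c \<inter> U" "y = snd c x" using sub by blast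
    then show "q \<in> fst c \<inter> U" using y c by simp
  qed
  have one: "\<phi> q = 1" if qV: "q \<in> V" for q
  proof -
    obtain y where y: "y \<in> ball (snd c p) s" "q = chart_inv c y"
      using qV unfolding V_def by blast
    moreover obtain x where "x \<in> fst c \<inter> U" "y = snd c x" using sub y by blast
    ultimately show ?thesis using c \<psi>(3) by (simp add: \<phi>_def)
  qed
  have "compact K"
    unfolding K_def using r(2) homeomorphism_cont2[OF chart_homeomorphism[OF c]]
    by (intro compact_continuous_image) (auto intro: continuous_on_subset)
  then have K: "closed K" by (rule compact_imp_closed)
  have KU: "K \<subseteq> fst c \<inter> U"
  proof
    fix q assume "q \<in> K"
    then obtain y where y: "y \<in> cball (snd c p) r" "q = chart_inv c y"
      unfolding K_def by blast
    then obtain x where "x \<in> fst c \<inter> U" "y = snd c x" using r(2) by blast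
    then show "q \<in> fst c \<inter> U" using y c by simp
  qed
  have off: "\<phi> q = 0" if "q \<notin> K" for q
  proof (cases "q \<in> fst c")
    case True
    then have "chart_inv c (snd c q) \<notin> K" using that c by simp
    then have "snd c q \<notin> cball (snd c p) r" unfolding K_def by blast
    then show ?thesis using \<psi>(4) by (simp add: \<phi>_def)
  qed (simp add: \<phi>_def)
  have ext: "smooth_fun A (\<lambda>q. \<phi> q * G (snd c q))" if G: "smooth_on ?W G" for G
  proof (rule smooth_funI, rule smooth_on_local)
    fix d y assume d: "d \<in> A" and "y \<in> snd d ` fst d"
    then obtain q where q: "q \<in> fst d" "y = snd d q" by auto
    let ?f = "\<lambda>y. \<phi> (chart_inv d y) * G (snd c (chart_inv d y))"
    show "\<exists>T. open T \<and> y \<in> T \<and> smooth_on T ?f"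
    proof (cases "q \<in> fst c \<inter> U")
      case True
      let ?T = "snd d ` (fst d \<inter> (fst c \<inter> U))"
      have T: "open ?T" using U(1) open_chart_domain[OF c] by (intro open_chart_image_Int d) auto
      have tr: "smooth_on ?T (\<lambda>y. snd c (chart_inv d y))"
        by (rule smooth_on_subset[OF smooth_transition[OF c d]]) auto
      have G': "smooth_on ?W (\<lambda>y. \<psi> y * G y)"
        by (intro smooth_on_mult W G smooth_on_subset[OF \<psi>(2)]) auto
      have "smooth_on ?T (\<lambda>y. \<psi> (snd c (chart_inv d y)) * G (snd c (chart_inv d y)))"
        using d by (intro smooth_on_compose[OF T W G' tr]) auto
      then have "smooth_on ?T ?f"
        by (rule smooth_on_cong[OF T, rotated]) (use d in \<open>auto simp: \<phi>_def\<close>)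
      then show ?thesis using T True q by blast
    next
      case False
      let ?T = "snd d ` (fst d \<inter> - K)"
      have T: "open ?T" using K by (intro open_chart_image_Int d) auto
      have "smooth_on ?T ?f"
        by (rule smooth_on_cong[OF T _ smooth_on_const[OF T, of 0]]) (use d off in auto)
      then show ?thesis using T False q KU by blast
    qed
  qed
  have "smooth_fun A \<phi>" using ext[OF smooth_on_const[OF W, of 1]] by simp
  moreover have "\<phi> q = 0" if "q \<notin> fst c \<inter> U" for q
    using off[of q] KU that by blast
  ultimately show ?thesis using that[OF _ V \<open>p \<in> V\<close> VU one _ ext] by blast
qed

section \<open>Coordinate vectors form a basis of the tangent space\<close>

lemma tangent_space_add: "v \<in> tangent_space A p \<Longrightarrow> smooth_fun A f \<Longrightarrow> smooth_fun A h
    \<Longrightarrow> v (\<lambda>x. f x + h x) = v f + v h"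
  and tangent_space_scale: "v \<in> tangent_space A p \<Longrightarrow> smooth_fun A f \<Longrightarrow> v (\<lambda>x. r * f x) = r * v f"
  and tangent_space_leibniz: "v \<in> tangent_space A p \<Longrightarrow> smooth_fun A f \<Longrightarrow> smooth_fun A h
    \<Longrightarrow> v (\<lambda>x. f x * h x) = f p * v h + h p * v f"
  and tangent_space_not_smooth: "v \<in> tangent_space A p \<Longrightarrow> \<not> smooth_fun A f \<Longrightarrow> v f = 0"
  by (auto simp: tangent_space_def)

lemma tangent_space_const:
  assumes "v \<in> tangent_space A p"
  shows "v (\<lambda>x. r) = 0"
proof -
  have "v (\<lambda>x. 1 * 1) = v (\<lambda>x. 1) + v (\<lambda>x. 1)"
    using tangent_space_leibniz[OF assms smooth_fun_const[of 1] smooth_fun_const[of 1]] by simp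
  then show ?thesis
    using tangent_space_scale[OF assms smooth_fun_const[of 1], of r] by simp
qed

lemma tangent_space_sum:
  assumes "v \<in> tangent_space A p" "finite I" "\<And>i. i \<in> I \<Longrightarrow> smooth_fun A (f i)"
  shows "v (\<lambda>x. \<Sum>i\<in>I. f i x) = (\<Sum>i\<in>I. v (f i))"
  using assms(2,3)
  by (induction I rule: finite_induct)
     (simp_all add: tangent_space_const[OF assms(1)] tangent_space_add[OF assms(1)] smooth_fun_sum)

text \<open>
  A cutoff \<open>\<phi>\<close> supported in \<open>U\<close> with \<open>\<phi> p = 1\<close> gives \<open>\<phi> f = \<phi> h\<close> everywhere; the Leibniz rule
  recovers \<open>v f\<close> and \<open>v h\<close> from these products up to equal terms.
\<close>

lemma tangent_space_local:
  assumes v: "v \<in> tangent_space A p" and f: "smooth_fun A f" and h: "smooth_fun A h"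
    and U: "open U" "p \<in> U" "\<And>q. q \<in> U \<Longrightarrow> f q = h q"
  shows "v f = v h"
proof -
  have "p \<in> (\<Union>c\<in>A. fst c)" using smooth_structure unfolding smooth_structure_def by simp
  then obtain c where c: "c \<in> A" "p \<in> fst c" by blast
  obtain \<phi> V where \<phi>: "smooth_fun A \<phi>" "p \<in> V" "\<And>q. q \<in> V \<Longrightarrow> \<phi> q = (1::real)"
    "\<And>q. q \<notin> fst c \<inter> U \<Longrightarrow> \<phi> q = 0"
    by (rule smooth_cutoff[OF c U(1,2)]) (rule that)
  have eq: "\<phi> q * f q = \<phi> q * h q" for q
    by (cases "q \<in> U") (simp_all add: U(3) \<phi>(4))
  have one: "\<phi> p = 1" using \<phi>(2,3) by blast
  have "v f + f p * v \<phi> = v (\<lambda>q. \<phi> q * f q)"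
    unfolding tangent_space_leibniz[OF v \<phi>(1) f] one by simp
  also have "\<dots> = v h + h p * v \<phi>"
    unfolding eq tangent_space_leibniz[OF v \<phi>(1) h] one by simp
  finally show ?thesis unfolding U(3)[OF U(2)] by simp
qed

lemma smooth_fun_has_derivative:
  assumes "smooth_fun A f" "c \<in> A" "q \<in> fst c"
  shows "(f \<circ> chart_inv c has_derivative frechet_derivative (f \<circ> chart_inv c) (at (snd c q)))
    (at (snd c q))"
  using smooth_on_has_derivative[OF smooth_fun_chart[OF assms(1,2)], of "snd c q"] assms(3)
  by (simp add: o_def)

lemma coord_vec_tangent:
  assumes c: "c \<in> A" "q \<in> fst c"
  shows "coord_vec A c i q \<in> tangent_space A q"
proof -
  let ?D = "\<lambda>f. frechet_derivative (f \<circ> chart_inv c) (at (snd c q))"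
  have d: "(f \<circ> chart_inv c has_derivative ?D f) (at (snd c q))" if "smooth_fun A f" for f
    using smooth_fun_has_derivative[OF that c] .
  have "?D (\<lambda>x. f x + h x) w = ?D f w + ?D h w" if "smooth_fun A f" "smooth_fun A h" for f h w
  proof -
    have "((\<lambda>x. f x + h x) \<circ> chart_inv c has_derivative (\<lambda>w. ?D f w + ?D h w)) (at (snd c q))"
      using has_derivative_add[OF d[OF that(1)] d[OF that(2)]] by (simp add: o_def)
    then show ?thesis by (simp add: frechet_derivative_at[symmetric])
  qed
  moreover have "?D (\<lambda>x. f x * h x) w = f q * ?D h w + h q * ?D f w"
    if "smooth_fun A f" "smooth_fun A h" for f h w
  proof -
    have "((\<lambda>x. f x * h x) \<circ> chart_inv c has_derivative (\<lambda>w. f q * ?D h w + ?D f w * h q))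
        (at (snd c q))"
      using has_derivative_mult[OF d[OF that(1)] d[OF that(2)]] c by (simp add: o_def)
    then show ?thesis by (simp add: frechet_derivative_at[symmetric])
  qed
  moreover have "?D (\<lambda>x. r * f x) w = r * ?D f w" if "smooth_fun A f" for f r w
  proof -
    have "((\<lambda>x. r * f x) \<circ> chart_inv c has_derivative (\<lambda>w. r * ?D f w)) (at (snd c q))"
      using has_derivative_mult_right[OF d[OF that], of r] by (simp add: o_def)
    then show ?thesis by (simp add: frechet_derivative_at[symmetric])
  qed
  moreover have "smooth_fun A (\<lambda>x. r * f x)" if "smooth_fun A f" for f r
    using smooth_fun_mult[OF smooth_fun_const that] .
  ultimately show ?thesis
    using smooth_fun_add smooth_fun_mult by (simp add: tangent_space_def coord_vec_def)
qed

text \<open>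
  Tangent vectors act on global functions only, hence the extension of the coordinates. One family
  serves all points of \<open>V\<close>; this uniformity yields smooth coefficients for a vector field near \<open>p\<close>.
\<close>

lemma coord_fun_exists:
  assumes c: "c \<in> A" "p \<in> fst c"
  obtains \<xi> :: "'n \<Rightarrow> 'a \<Rightarrow> real" and V where "open V" "p \<in> V" "V \<subseteq> fst c"
    "\<And>i. smooth_fun A (\<xi> i)" "\<And>i q. q \<in> V \<Longrightarrow> \<xi> i q = snd c q $ i"
proof -
  obtain \<phi> V where \<phi>: "open V" "p \<in> V" "V \<subseteq> fst c \<inter> UNIV" "\<And>q. q \<in> V \<Longrightarrow> \<phi> q = (1::real)"
    "\<And>G. smooth_on (snd c ` (fst c \<inter> UNIV)) G \<Longrightarrow> smooth_fun A (\<lambda>q. \<phi> q * G (snd c q))"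
    by (rule smooth_cutoff[OF c open_UNIV UNIV_I]) (rule that)
  have "smooth_fun A (\<lambda>q. \<phi> q * snd c q $ i)" for i
    using \<phi>(5)[OF smooth_on_bounded_linear[OF bounded_linear_vec_nth]] open_chart_image[OF c(1)]
    by simp
  then show ?thesis using \<phi>(1-4) by (intro that[of V "\<lambda>i q. \<phi> q * snd c q $ i"]) auto
qed

text \<open>
  By Hadamard's expansion \<open>f\<close> is, near \<open>q\<close>, a constant plus a sum of products of
  \<open>\<xi> i - \<xi> i q\<close>, vanishing at \<open>q\<close>, with functions whose value at \<open>q\<close> is \<open>\<partial>\<^sub>i f\<close>. By the
  Leibniz rule only the derivatives of the first factors contribute.
\<close>

lemma tangent_vector_expansion:
  assumes c: "c \<in> A" "q \<in> fst c" and v: "v \<in> tangent_space A q"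
    and \<xi>: "open V" "q \<in> V" "\<And>i. smooth_fun A (\<xi> i)" "\<And>i x. x \<in> V \<Longrightarrow> \<xi> i x = snd c x $ i"
  shows "v = (\<lambda>f. \<Sum>i\<in>UNIV. v (\<xi> i) * coord_vec A c i q f)"
proof
  fix f
  show "v f = (\<Sum>i\<in>UNIV. v (\<xi> i) * coord_vec A c i q f)"
  proof (cases "smooth_fun A f")
    case False
    then show ?thesis using tangent_space_not_smooth[OF v] by (simp add: coord_vec_def)
  next
    case f: True
    let ?a = "snd c q" and ?F = "\<lambda>y. f (chart_inv c y)"
    obtain r where r: "r > 0" "ball ?a r \<subseteq> snd c ` fst c"
      using open_chart_image[OF c(1)] c(2) open_contains_ball by blast
    have F: "smooth_on (ball ?a r) ?F"
      by (rule smooth_on_subset[OF smooth_fun_chart[OF f c(1)] r(2)])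
    obtain G where G: "\<And>i. smooth_on (ball ?a r) (G i)"
      "\<And>y. y \<in> ball ?a r \<Longrightarrow> ?F y = ?F ?a + (\<Sum>i\<in>UNIV. (y $ i - ?a $ i) * G i y)"
      "\<And>i. G i ?a = frechet_derivative ?F (at ?a) (axis i 1)"
      by (rule hadamard_expansion[OF F]) (rule that)
    \<comment> \<open>the expansion is available on the ball only, so its functions are cut off within the preimage \<open>U\<close>\<close>
    define U where "U = chart_inv c ` ball ?a r"
    have U: "open U" unfolding U_def by (rule open_chart_inv_image[OF c(1) open_ball r(2)])
    have "q \<in> U" unfolding U_def using c r(1) by (intro image_eqI[of _ _ ?a]) auto
    have img: "snd c ` (fst c \<inter> U) \<subseteq> ball ?a r"
    proof
      fix y assume "y \<in> snd c ` (fst c \<inter> U)"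
      then obtain x z where "x \<in> fst c" "y = snd c x" "z \<in> ball ?a r" "x = chart_inv c z"
        unfolding U_def by blast
      moreover obtain w where "w \<in> fst c" "z = snd c w" using \<open>z \<in> ball ?a r\<close> r(2) by blast
      ultimately show "y \<in> ball ?a r" using c by simp
    qed
    obtain \<phi> W where \<phi>: "open W" "q \<in> W" "W \<subseteq> fst c \<inter> U" "\<And>x. x \<in> W \<Longrightarrow> \<phi> x = (1::real)"
      "\<And>G. smooth_on (snd c ` (fst c \<inter> U)) G \<Longrightarrow> smooth_fun A (\<lambda>x. \<phi> x * G (snd c x))"
      by (rule smooth_cutoff[OF c U \<open>q \<in> U\<close>]) (rule that)
    define g where "g i x = \<phi> x * G i (snd c x)" for i x
    have g: "smooth_fun A (g i)" for i
      unfolding g_def[abs_def] by (intro \<phi>(5) smooth_on_subset[OF G(1) img])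
    have \<xi>': "smooth_fun A (\<lambda>x. \<xi> i x + - (?a $ i))" for i
      by (intro smooth_fun_add smooth_fun_const \<xi>)
    let ?h = "\<lambda>x. f q + (\<Sum>i\<in>UNIV. (\<xi> i x + - (?a $ i)) * g i x)"
    have terms: "smooth_fun A (\<lambda>x. (\<xi> i x + - (?a $ i)) * g i x)" for i
      by (intro smooth_fun_mult \<xi>' g)
    have sums: "smooth_fun A (\<lambda>x. \<Sum>i\<in>UNIV. (\<xi> i x + - (?a $ i)) * g i x)"
      by (intro smooth_fun_sum terms)
    have "f x = ?h x" if "x \<in> V \<inter> W" for x
    proof -
      have x: "x \<in> fst c" "snd c x \<in> ball ?a r" using that \<phi>(3) img by blast+
      show ?thesis using G(2)[OF x(2)] x(1) that c \<phi>(4) \<xi>(4) by (simp add: g_def)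
    qed
    then have "v f = v ?h"
      using \<xi>(1,2) \<phi>(1,2)
      by (intro tangent_space_local[OF v f smooth_fun_add[OF smooth_fun_const sums], of "V \<inter> W"])
         blast+
    also have "\<dots> = (\<Sum>i\<in>UNIV. v (\<lambda>x. (\<xi> i x + - (?a $ i)) * g i x))"
      by (simp only: tangent_space_add[OF v smooth_fun_const sums] tangent_space_const[OF v]
            tangent_space_sum[OF v finite terms] add_0)
    also have "\<dots> = (\<Sum>i\<in>UNIV. v (\<xi> i) * coord_vec A c i q f)"
    proof (rule sum.cong[OF refl])
      fix i
      have "v (\<lambda>x. (\<xi> i x + - (?a $ i)) * g i x)
          = (\<xi> i q + - (?a $ i)) * v (g i) + g i q * v (\<lambda>x. \<xi> i x + - (?a $ i))"
        by (rule tangent_space_leibniz[OF v \<xi>' g])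
      also have "v (\<lambda>x. \<xi> i x + - (?a $ i)) = v (\<xi> i)"
        by (simp only: tangent_space_add[OF v \<xi>(3) smooth_fun_const] tangent_space_const[OF v]
              add_0_right)
      also have "(\<xi> i q + - (?a $ i)) * v (g i) + g i q * v (\<xi> i) = g i q * v (\<xi> i)"
        using \<xi>(2,4) by simp
      also have "g i q = coord_vec A c i q f"
        using f \<phi>(2,4) G(3) by (simp add: g_def coord_vec_def o_def)
      finally show "v (\<lambda>x. (\<xi> i x + - (?a $ i)) * g i x) = v (\<xi> i) * coord_vec A c i q f"
        by (simp add: mult.commute)
    qed
    finally show ?thesis .
  qed
qed

lemma coord_vec_coord_fun:
  assumes c: "c \<in> A" "q \<in> fst c"
    and \<xi>: "open V" "q \<in> V" "\<And>i. smooth_fun A (\<xi> i)" "\<And>i x. x \<in> V \<Longrightarrow> \<xi> i x = snd c x $ i"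
  shows "coord_vec A c i q (\<xi> j) = (if i = j then 1 else 0)"
proof -
  let ?T = "snd c ` (fst c \<inter> V)"
  have T: "open ?T" by (rule open_chart_image_Int[OF c(1) \<xi>(1)])
  have "((\<lambda>y. y $ j) has_derivative (\<lambda>w. w $ j)) (at (snd c q))"
    by (rule bounded_linear_imp_has_derivative[OF bounded_linear_vec_nth])
  then have "(\<xi> j \<circ> chart_inv c has_derivative (\<lambda>w. w $ j)) (at (snd c q))"
    by (rule has_derivative_transform_within_open[OF _ T]) (use c \<xi> in auto)
  then have "frechet_derivative (\<xi> j \<circ> chart_inv c) (at (snd c q)) = (\<lambda>w. w $ j)"
    using frechet_derivative_at by metis
  then show ?thesis using \<xi>(3) by (simp add: coord_vec_def axis_def)
qed

text \<open>
  Components are evaluations at fixed functions. In particular they are linear in the vector, which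
  the definition through a unique choice hides.
\<close>

lemma vec_comp_eq:
  assumes c: "c \<in> A" "q \<in> fst c" and v: "v \<in> tangent_space A q"
    and \<xi>: "open V" "q \<in> V" "\<And>i. smooth_fun A (\<xi> i)" "\<And>i x. x \<in> V \<Longrightarrow> \<xi> i x = snd c x $ i"
  shows "vec_comp A c q v j = v (\<xi> j)"
proof -
  have "(THE a. v = (\<lambda>f. \<Sum>k\<in>UNIV. a $ k * coord_vec A c k q f)) = (\<chi> k. v (\<xi> k))"
  proof (rule the_equality)
    show "v = (\<lambda>f. \<Sum>k\<in>UNIV. (\<chi> k. v (\<xi> k)) $ k * coord_vec A c k q f)"
      using tangent_vector_expansion[OF c v \<xi>] by simp
    fix a assume a: "v = (\<lambda>f. \<Sum>k\<in>UNIV. a $ k * coord_vec A c k q f)"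
    have "v (\<xi> k) = a $ k" for k
      by (subst a) (simp add: coord_vec_coord_fun[OF c \<xi>] if_distrib cong: if_cong)
    then show "a = (\<chi> k. v (\<xi> k))" by (simp add: vec_eq_iff)
  qed
  then show ?thesis by (simp add: vec_comp_def)
qed

section \<open>Vector fields\<close>

lemma vector_field_tangent: "vector_field A X \<Longrightarrow> X p \<in> tangent_space A p"
  and vector_field_smooth: "vector_field A X \<Longrightarrow> smooth_fun A f \<Longrightarrow> smooth_fun A (\<lambda>p. X p f)"
  by (auto simp: vector_field_def)

lemma tangent_space_zero: "(\<lambda>f. 0) \<in> tangent_space A p"
  by (simp add: tangent_space_def)

lemma tangent_space_lincomb:
  assumes u: "u \<in> tangent_space A p" and v: "v \<in> tangent_space A p"
  shows "(\<lambda>f. r * u f + s * v f) \<in> tangent_space A p"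
  unfolding tangent_space_def
  by (auto simp: tangent_space_add[OF u] tangent_space_add[OF v] tangent_space_scale[OF u]
      tangent_space_scale[OF v] tangent_space_leibniz[OF u] tangent_space_leibniz[OF v]
      tangent_space_not_smooth[OF u] tangent_space_not_smooth[OF v] algebra_simps)

lemma tangent_space_scaled: "u \<in> tangent_space A p \<Longrightarrow> (\<lambda>f. r * u f) \<in> tangent_space A p"
  using tangent_space_lincomb[of u p u r 0] by simp

lemma vector_field_add:
  assumes "vector_field A X" "vector_field A Y"
  shows "vector_field A (\<lambda>p f. X p f + Y p f)"
  unfolding vector_field_def
  using tangent_space_lincomb[of "X _" _ "Y _" 1 1] assms
  by (auto intro: vector_field_tangent vector_field_smooth smooth_fun_add)

lemma vector_field_scale:
  assumes "vector_field A X" "smooth_fun A h"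
  shows "vector_field A (\<lambda>p f. h p * X p f)"
  unfolding vector_field_def using assms
  by (auto intro: tangent_space_scaled vector_field_tangent vector_field_smooth smooth_fun_mult)

lemma vector_field_zero: "vector_field A (\<lambda>p f. 0)"
  by (simp add: vector_field_def tangent_space_zero smooth_fun_const)

lemma vector_field_sum:
  "finite I \<Longrightarrow> (\<And>m. m \<in> I \<Longrightarrow> vector_field A (X m)) \<Longrightarrow> vector_field A (\<lambda>p f. \<Sum>m\<in>I. X m p f)"
  by (induction I rule: finite_induct) (simp_all add: vector_field_zero vector_field_add)

lemma vector_field_lincomb:
  assumes "vector_field A X" "vector_field A Y"
  shows "vector_field A (\<lambda>p f. r * X p f + s * Y p f)"
  using assms by (intro vector_field_add vector_field_scale smooth_fun_const)

lemma vector_field_diff: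
  assumes "vector_field A X" "vector_field A Y"
  shows "vector_field A (\<lambda>p f. X p f - Y p f)"
  using vector_field_lincomb[OF assms, of 1 "- 1"] by simp

lemma vector_field_lie_bracket:
  assumes X: "vector_field A X" and Y: "vector_field A Y"
  shows "vector_field A (lie_bracket X Y)"
proof -
  note XY = vector_field_tangent[OF X] vector_field_tangent[OF Y]
  note sm = vector_field_smooth[OF X] vector_field_smooth[OF Y]
  have "lie_bracket X Y p \<in> tangent_space A p" for p
    unfolding tangent_space_def mem_Collect_eq
  proof (intro conjI allI impI; (elim conjE)?)
    fix f assume "\<not> smooth_fun A f"
    then have "(\<lambda>q. X q f) = (\<lambda>q. 0)" "(\<lambda>q. Y q f) = (\<lambda>q. 0)"
      using tangent_space_not_smooth XY by blast+
    then show "lie_bracket X Y p f = 0"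
      using tangent_space_const[OF XY(1)] tangent_space_const[OF XY(2)] by (simp add: lie_bracket_def)
  next
    fix f h assume "smooth_fun A f" "smooth_fun A h"
    then show "lie_bracket X Y p (\<lambda>x. f x + h x) = lie_bracket X Y p f + lie_bracket X Y p h"
      by (simp add: lie_bracket_def tangent_space_add[OF XY(1)] tangent_space_add[OF XY(2)] sm)
  next
    fix r f assume "smooth_fun A f"
    then show "lie_bracket X Y p (\<lambda>x. r * f x) = r * lie_bracket X Y p f"
      by (simp add: lie_bracket_def tangent_space_scale[OF XY(1)] tangent_space_scale[OF XY(2)] sm
          right_diff_distrib)
  next
    fix f h assume "smooth_fun A f" "smooth_fun A h"
    then show "lie_bracket X Y p (\<lambda>x. f x * h x) = f p * lie_bracket X Y p h + h p * lie_bracket X Y p f"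
      by (simp add: lie_bracket_def tangent_space_leibniz[OF XY(1)] tangent_space_leibniz[OF XY(2)]
          tangent_space_add[OF XY(1)] tangent_space_add[OF XY(2)] sm smooth_fun_mult algebra_simps)
  qed
  moreover have "smooth_fun A (\<lambda>p. lie_bracket X Y p f)" if "smooth_fun A f" for f
    using smooth_fun_add[OF sm(1)[OF sm(2)[OF that]]
        smooth_fun_mult[OF smooth_fun_const[of "- 1"] sm(2)[OF sm(1)[OF that]]]]
    by (simp add: lie_bracket_def)
  ultimately show ?thesis by (simp add: vector_field_def)
qed

text \<open>
  The field \<open>\<partial>\<^sub>i\<close> cut off near \<open>p\<close> witnesses that the choice in the definition is not vacuous.
\<close>

lemma coord_field:
  assumes c: "c \<in> A" "p \<in> fst c"
  shows "vector_field A (coord_field A c p i)"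
    and "\<exists>V. open V \<and> p \<in> V \<and> V \<subseteq> fst c \<and> (\<forall>q\<in>V. coord_field A c p i q = coord_vec A c i q)"
proof -
  obtain \<phi> V where \<phi>: "open V" "p \<in> V" "V \<subseteq> fst c \<inter> UNIV" "\<And>q. q \<in> V \<Longrightarrow> \<phi> q = (1::real)"
    "\<And>q. q \<notin> fst c \<inter> UNIV \<Longrightarrow> \<phi> q = 0"
    "\<And>G. smooth_on (snd c ` (fst c \<inter> UNIV)) G \<Longrightarrow> smooth_fun A (\<lambda>q. \<phi> q * G (snd c q))"
    by (rule smooth_cutoff[OF c open_UNIV UNIV_I]) (rule that)
  let ?X = "\<lambda>q f. \<phi> q * coord_vec A c i q f"
  have "?X q \<in> tangent_space A q" for q
  proof (cases "q \<in> fst c")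
    case True
    then show ?thesis by (intro tangent_space_scaled coord_vec_tangent c)
  next
    case False
    then show ?thesis using \<phi>(5) tangent_space_zero by simp
  qed
  moreover have "smooth_fun A (\<lambda>q. ?X q f)" if f: "smooth_fun A f" for f
    using \<phi>(6)[of "\<lambda>y. frechet_derivative (\<lambda>y. f (chart_inv c y)) (at y) (axis i 1)"]
      smooth_on_frechet_derivative[OF smooth_fun_chart[OF f c(1)]] f
    by (simp add: coord_vec_def o_def)
  ultimately have "vector_field A ?X" by (simp add: vector_field_def)
  moreover have "\<forall>q\<in>V. ?X q = coord_vec A c i q" using \<phi>(4) by simp
  ultimately have ex: "\<exists>X. vector_field A X \<and>
     (\<exists>V. open V \<and> p \<in> V \<and> V \<subseteq> fst c \<and> (\<forall>q\<in>V. X q = coord_vec A c i q))"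
    using \<phi>(1-3) by blast
  show "vector_field A (coord_field A c p i)"
    and "\<exists>V. open V \<and> p \<in> V \<and> V \<subseteq> fst c \<and> (\<forall>q\<in>V. coord_field A c p i q = coord_vec A c i q)"
    using someI_ex[OF ex] unfolding coord_field_def by blast+
qed

section \<open>Tensoriality\<close>

text \<open>
  Linearity over the ring of smooth functions, the property by which tensors are recognised among
  operators on vector fields.
\<close>

definition function_linear :: "('a vfield \<Rightarrow> 'a vfield) \<Rightarrow> bool" where
  "function_linear L \<longleftrightarrow>
     (\<forall>Y. vector_field A Y \<longrightarrow> vector_field A (L Y)) \<and>
     (\<forall>Y Z. vector_field A Y \<and> vector_field A Z \<longrightarrow>
        L (\<lambda>p f. Y p f + Z p f) = (\<lambda>p f. L Y p f + L Z p f)) \<and>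
     (\<forall>h Y. smooth_fun A h \<and> vector_field A Y \<longrightarrow>
        L (\<lambda>p f. h p * Y p f) = (\<lambda>p f. h p * L Y p f))"

lemma
  assumes "function_linear L"
  shows function_linear_field: "vector_field A Y \<Longrightarrow> vector_field A (L Y)"
    and function_linear_add: "vector_field A Y \<Longrightarrow> vector_field A Z \<Longrightarrow>
      L (\<lambda>p f. Y p f + Z p f) = (\<lambda>p f. L Y p f + L Z p f)"
    and function_linear_scale: "smooth_fun A h \<Longrightarrow> vector_field A Y \<Longrightarrow>
      L (\<lambda>p f. h p * Y p f) = (\<lambda>p f. h p * L Y p f)"
  using assms unfolding function_linear_def by blast+

lemma function_linear_sum:
  assumes L: "function_linear L" and "finite I" "\<And>m. m \<in> I \<Longrightarrow> smooth_fun A (h m)"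
    "\<And>m. m \<in> I \<Longrightarrow> vector_field A (Y m)"
  shows "L (\<lambda>p f. \<Sum>m\<in>I. h m p * Y m p f) = (\<lambda>p f. \<Sum>m\<in>I. h m p * L (Y m) p f)"
  using assms(2-)
proof (induction I rule: finite_induct)
  case empty
  have "L (\<lambda>p f. 0 * 0) = (\<lambda>p f. 0 * L (\<lambda>p f. 0) p f)"
    by (rule function_linear_scale[OF L smooth_fun_const vector_field_zero])
  then show ?case by simp
next
  case (insert m I)
  have "vector_field A (\<lambda>p f. h m p * Y m p f)"
    using insert by (intro vector_field_scale) auto
  moreover have "vector_field A (\<lambda>p f. \<Sum>m\<in>I. h m p * Y m p f)"
    using insert by (intro vector_field_sum vector_field_scale) auto
  ultimately have "L (\<lambda>p f. h m p * Y m p f + (\<Sum>m\<in>I. h m p * Y m p f))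
      = (\<lambda>p f. L (\<lambda>p f. h m p * Y m p f) p f + L (\<lambda>p f. \<Sum>m\<in>I. h m p * Y m p f) p f)"
    by (rule function_linear_add[OF L])
  moreover have "L (\<lambda>p f. h m p * Y m p f) = (\<lambda>p f. h m p * L (Y m) p f)"
    using insert by (intro function_linear_scale L) auto
  ultimately show ?case using insert by simp
qed

text \<open>
  Near \<open>p\<close> the field \<open>W\<close> is the combination of the frame \<open>E m\<close> with the smooth coefficients \<open>W (\<xi> m)\<close>.
  Multiplied by a cutoff the identity holds on the whole manifold, where linearity over smooth functions
  applies, and at \<open>p\<close> the cutoff is 1.
\<close>

lemma function_linear_expansion:
  assumes c: "c \<in> A" and L: "function_linear L" and W: "vector_field A W"
    and V: "open V" "p \<in> V" "V \<subseteq> fst c"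
    and \<xi>: "\<And>i. smooth_fun A (\<xi> i)" "\<And>i q. q \<in> V \<Longrightarrow> \<xi> i q = snd c q $ i"
    and E: "\<And>i. vector_field A (E i)" "\<And>i q. q \<in> V \<Longrightarrow> E i q = coord_vec A c i q"
  shows "L W p f = (\<Sum>m\<in>UNIV. W p (\<xi> m) * L (E m) p f)"
proof -
  have p: "p \<in> fst c" using V by blast
  obtain \<phi> U where \<phi>: "smooth_fun A \<phi>" "p \<in> U" "\<And>q. q \<in> U \<Longrightarrow> \<phi> q = (1::real)"
    "\<And>q. q \<notin> fst c \<inter> V \<Longrightarrow> \<phi> q = 0"
    by (rule smooth_cutoff[OF c p V(1,2)]) (rule that)
  let ?h = "\<lambda>m q. \<phi> q * W q (\<xi> m)"
  have h: "smooth_fun A (?h m)" for m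
    by (rule smooth_fun_mult[OF \<phi>(1) vector_field_smooth[OF W \<xi>(1)]])
  have "\<phi> q * W q f = (\<Sum>m\<in>UNIV. ?h m q * E m q f)" for q f
  proof (cases "q \<in> fst c \<inter> V")
    case True
    then have q: "q \<in> fst c" "q \<in> V" by auto
    have "W q f = (\<Sum>m\<in>UNIV. W q (\<xi> m) * coord_vec A c m q f)"
      by (rule fun_cong[OF tangent_vector_expansion[OF c q(1) vector_field_tangent[OF W] V(1) q(2) \<xi>]])
    then have "\<phi> q * W q f = \<phi> q * (\<Sum>m\<in>UNIV. W q (\<xi> m) * coord_vec A c m q f)"
      by (rule arg_cong)
    also have "\<dots> = (\<Sum>m\<in>UNIV. ?h m q * E m q f)"
      by (simp add: sum_distrib_left mult.assoc E(2)[OF q(2)])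
    finally show ?thesis .
  next
    case False
    then show ?thesis using \<phi>(4) by simp
  qed
  then have "L (\<lambda>q f. \<phi> q * W q f) = L (\<lambda>q f. \<Sum>m\<in>UNIV. ?h m q * E m q f)"
    by (intro arg_cong[of _ _ L] ext)
  also have "\<dots> = (\<lambda>q f. \<Sum>m\<in>UNIV. ?h m q * L (E m) q f)"
    by (rule function_linear_sum[OF L finite h E(1)])
  also have "L (\<lambda>q f. \<phi> q * W q f) = (\<lambda>q f. \<phi> q * L W q f)"
    by (rule function_linear_scale[OF L \<phi>(1) W])
  finally have "(\<lambda>q f. \<phi> q * L W q f) = (\<lambda>q f. \<Sum>m\<in>UNIV. ?h m q * L (E m) q f)" .
  from fun_cong[OF fun_cong[OF this, of p], of f] show ?thesis using \<phi>(2,3) by simp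
qed

section \<open>Curvature of the alpha-connection\<close>

lemma
  assumes "affine_connection A D"
  shows connection_vector_field: "vector_field A X \<Longrightarrow> vector_field A Y \<Longrightarrow> vector_field A (D X Y)"
    and connection_add: "vector_field A X \<Longrightarrow> vector_field A Y \<Longrightarrow> vector_field A Z \<Longrightarrow>
      D X (\<lambda>p f. Y p f + Z p f) = (\<lambda>p f. D X Y p f + D X Z p f)"
    and connection_leibniz: "smooth_fun A h \<Longrightarrow> vector_field A X \<Longrightarrow> vector_field A Y \<Longrightarrow>
      D X (\<lambda>p f. h p * Y p f) = (\<lambda>p f. X p h * Y p f + h p * D X Y p f)"
  using assms unfolding affine_connection_def by blast+

lemma connection_lincomb:
  assumes D: "affine_connection A D" and X: "vector_field A X"
    and Y: "vector_field A Y" and Z: "vector_field A Z"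
  shows "D X (\<lambda>p f. r * Y p f + s * Z p f) = (\<lambda>p f. r * D X Y p f + s * D X Z p f)"
proof -
  have const: "D X (\<lambda>p f. t * T p f) = (\<lambda>p f. t * D X T p f)" if T: "vector_field A T" for t T
    using connection_leibniz[OF D smooth_fun_const X T]
    by (simp add: tangent_space_const[OF vector_field_tangent[OF X]])
  have "D X (\<lambda>p f. r * Y p f + s * Z p f)
      = (\<lambda>p f. D X (\<lambda>p f. r * Y p f) p f + D X (\<lambda>p f. s * Z p f) p f)"
    by (rule connection_add[OF D X]) (intro vector_field_scale smooth_fun_const Y Z)+
  then show ?thesis by (simp add: const Y Z)
qed

lemma connection_diff:
  assumes "affine_connection A D" "vector_field A X" "vector_field A Y" "vector_field A Z"
  shows "D X (\<lambda>p f. Y p f - Z p f) = (\<lambda>p f. D X Y p f - D X Z p f)"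
  using connection_lincomb[OF assms, of 1 "- 1"] by simp

text \<open>
  The derivative terms \<open>X h * Y\<close> of the two Leibniz rules cancel.
\<close>

lemma difference_tensor_function_linear:
  assumes D: "affine_connection A D" and D': "affine_connection A D'" and X: "vector_field A X"
  shows "function_linear (difference_tensor D D' X)"
proof -
  note vf = connection_vector_field[OF D X] connection_vector_field[OF D' X]
  have "D' X (\<lambda>p f. Y p f + Z p f) p f - D X (\<lambda>p f. Y p f + Z p f) p f
      = (D' X Y p f - D X Y p f) + (D' X Z p f - D X Z p f)"
    if "vector_field A Y" "vector_field A Z" for Y Z p f
    unfolding connection_add[OF D X that] connection_add[OF D' X that] by simp
  moreover have "D' X (\<lambda>p f. h p * Y p f) p f - D X (\<lambda>p f. h p * Y p f) p f
      = h p * (D' X Y p f - D X Y p f)" if "smooth_fun A h" "vector_field A Y" for h Y p f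
    unfolding connection_leibniz[OF D that(1) X that(2)] connection_leibniz[OF D' that(1) X that(2)]
    by (simp add: right_diff_distrib)
  ultimately show ?thesis
    unfolding function_linear_def difference_tensor_def by (simp add: vector_field_diff vf)
qed

lemma curvature_vector_field:
  assumes D: "affine_connection A D"
    and X: "vector_field A X" and Y: "vector_field A Y" and Z: "vector_field A Z"
  shows "vector_field A (curvature D X Y Z)"
  unfolding curvature_def
  by (intro vector_field_diff connection_vector_field[OF D] vector_field_lie_bracket X Y Z)

text \<open>
  With \<open>a + b = 1\<close>, both sides agree after expansion; on the right the four products of \<open>\<nabla>\<close> and
  \<open>\<nabla>*\<close> in \<open>K(X, K(Y, Z))\<close> supply the mixed terms and correct \<open>a\<close> and \<open>b\<close> to \<open>a\<^sup>2\<close> and \<open>b\<^sup>2\<close>.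
\<close>

lemma curvature_alpha_connection:
  fixes \<alpha> :: real
  assumes D: "affine_connection A D" and D': "affine_connection A D'"
    and X: "vector_field A X" and Y: "vector_field A Y" and Z: "vector_field A Z"
  defines "K \<equiv> difference_tensor D D'"
  shows "curvature (alpha_connection \<alpha> D D') X Y Z p f =
    (1 + \<alpha>) / 2 * curvature D X Y Z p f + (1 - \<alpha>) / 2 * curvature D' X Y Z p f
      - (1 - \<alpha>\<^sup>2) / 4 * (K X (K Y Z) p f - K Y (K X Z) p f)"
proof -
  define a b where "a = (1 + \<alpha>) / 2" and "b = (1 - \<alpha>) / 2"
  have ab: "(1 - \<alpha>\<^sup>2) / 4 = a * b" "b = 1 - a"
    by (simp_all add: a_def b_def field_simps power2_eq_square)
  note vf = connection_vector_field[OF D] connection_vector_field[OF D'] X Y Z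
  note lin = connection_lincomb[OF D] connection_lincomb[OF D']
    connection_diff[OF D] connection_diff[OF D']
  show ?thesis
    unfolding K_def curvature_def alpha_connection_def difference_tensor_def
      a_def[symmetric] b_def[symmetric] ab(1)
    by (simp only: lin vf) (simp add: ab(2) algebra_simps)
qed

text \<open>
  Tensoriality of \<open>K\<close> turns the nested \<open>K(\<partial>\<^sub>k, K(\<partial>\<^sub>l, \<partial>\<^sub>i))\<close> into a product of components.
\<close>

lemma curv_comp_alpha_connection:
  fixes \<alpha> :: real
  assumes c: "c \<in> A" "p \<in> fst c"
    and D: "affine_connection A D" and D': "affine_connection A D'"
  defines "\<kappa> \<equiv> diff_comp A c D D' p"
  shows "curv_comp A c (alpha_connection \<alpha> D D') p i j k l =
    (1 + \<alpha>) / 2 * curv_comp A c D p i j k l + (1 - \<alpha>) / 2 * curv_comp A c D' p i j k l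
      - (1 - \<alpha>\<^sup>2) / 4 * (\<Sum>m\<in>UNIV. \<kappa> j k m * \<kappa> m l i - \<kappa> j l m * \<kappa> m k i)"
proof -
  let ?E = "coord_field A c p" and ?K = "difference_tensor D D'"
  obtain \<xi> :: "'n \<Rightarrow> 'a \<Rightarrow> real" and V0 where \<xi>0: "open V0" "p \<in> V0" "V0 \<subseteq> fst c"
    "\<And>i. smooth_fun A (\<xi> i)" "\<And>i q. q \<in> V0 \<Longrightarrow> \<xi> i q = snd c q $ i"
    by (rule coord_fun_exists[OF c]) (rule that)
  have "\<forall>i. \<exists>V. open V \<and> p \<in> V \<and> V \<subseteq> fst c \<and> (\<forall>q\<in>V. ?E i q = coord_vec A c i q)"
    using coord_field(2)[OF c] by blast
  then obtain U where U: "\<And>i. open (U i)" "\<And>i. p \<in> U i"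
    "\<And>i q. q \<in> U i \<Longrightarrow> ?E i q = coord_vec A c i q" by metis
  \<comment> \<open>a common neighbourhood for the coordinates and the finitely many fields of the frame\<close>
  define V where "V = V0 \<inter> (\<Inter>i\<in>UNIV. U i)"
  have V: "open V" "p \<in> V" "V \<subseteq> fst c"
    using \<xi>0(1-3) U(1,2) by (auto simp: V_def intro!: open_Int open_INT)
  have \<xi>: "\<And>i. smooth_fun A (\<xi> i)" "\<And>i q. q \<in> V \<Longrightarrow> \<xi> i q = snd c q $ i"
    using \<xi>0 by (auto simp: V_def)
  have E: "\<And>i. vector_field A (?E i)" "\<And>i q. q \<in> V \<Longrightarrow> ?E i q = coord_vec A c i q"
    using coord_field(1)[OF c] U by (auto simp: V_def)
  have lin: "function_linear (?K (?E i))" for i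
    using difference_tensor_function_linear[OF D D' E(1)] .
  have K: "vector_field A (?K (?E i) Y)" if "vector_field A Y" for i Y
    by (rule function_linear_field[OF lin that])
  have comp: "vec_comp A c p (Y p) m = Y p (\<xi> m)" if "vector_field A Y" for Y m
    by (rule vec_comp_eq[OF c vector_field_tangent[OF that] V(1,2) \<xi>])
  have \<kappa>: "\<kappa> m i l = ?K (?E i) (?E l) p (\<xi> m)" for m i l
    unfolding \<kappa>_def diff_comp_def by (intro comp K E)
  have KK: "?K (?E k) (?K (?E l) (?E i)) p (\<xi> j) = (\<Sum>m\<in>UNIV. \<kappa> j k m * \<kappa> m l i)" for k l
  proof -
    have "?K (?E k) (?K (?E l) (?E i)) p (\<xi> j) = (\<Sum>m\<in>UNIV. \<kappa> m l i * \<kappa> j k m)"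
      unfolding \<kappa> by (rule function_linear_expansion[OF c(1) lin K[OF E(1)] V \<xi> E])
    also have "\<dots> = (\<Sum>m\<in>UNIV. \<kappa> j k m * \<kappa> m l i)"
      by (rule sum.cong[OF refl mult.commute])
    finally show ?thesis .
  qed
  have R: "vector_field A (curvature C (?E k) (?E l) (?E i))" if "affine_connection A C" for C
    by (intro curvature_vector_field that E)
  let ?Ra = "\<lambda>q f. (1 + \<alpha>) / 2 * curvature D (?E k) (?E l) (?E i) q f
      + (1 - \<alpha>) / 2 * curvature D' (?E k) (?E l) (?E i) q f"
  let ?Rk = "\<lambda>q f. ?K (?E k) (?K (?E l) (?E i)) q f - ?K (?E l) (?K (?E k) (?E i)) q f"
  have "curvature (alpha_connection \<alpha> D D') (?E k) (?E l) (?E i)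
      = (\<lambda>q f. 1 * ?Ra q f + (- ((1 - \<alpha>\<^sup>2) / 4)) * ?Rk q f)"
    by (intro ext) (simp add: curvature_alpha_connection[OF D D' E(1) E(1) E(1)])
  moreover have "vector_field A \<dots>"
    by (intro vector_field_lincomb vector_field_diff R D D' K E)
  ultimately have "vector_field A (curvature (alpha_connection \<alpha> D D') (?E k) (?E l) (?E i))"
    by (simp only:)
  note comp_R = comp[OF this] comp[OF R[OF D]] comp[OF R[OF D']]
  show ?thesis
    unfolding curv_comp_def comp_R curvature_alpha_connection[OF D D' E(1) E(1) E(1)] KK
      sum_subtractf ..
qed

text \<open>
  The contraction pairs the upper index with the first direction of the curvature, which turns the commutator
  of the previous lemma into \<open>\<K>\<^sub>l\<^sub>j\<close> with the opposite sign.
\<close>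

lemma ricci_alpha_connection:
  fixes \<alpha> :: real
  assumes c: "c \<in> A" "p \<in> fst c"
    and D: "affine_connection A D" and D': "affine_connection A D'"
  shows "ricci A c (alpha_connection \<alpha> D D') p l j =
    (1 + \<alpha>) / 2 * ricci A c D p l j + (1 - \<alpha>) / 2 * ricci A c D' p l j
      + (1 - \<alpha>\<^sup>2) / 4 * diff_ricci A c D D' p l j"
proof -
  define \<kappa> where "\<kappa> = diff_comp A c D D' p"
  have "diff_ricci A c D D' p l j
      = - (\<Sum>i\<in>UNIV. \<Sum>m\<in>UNIV. \<kappa> i i m * \<kappa> m j l - \<kappa> i j m * \<kappa> m i l)"
    unfolding diff_ricci_def \<kappa>_def[symmetric] Let_def sum_negf[symmetric]
    by (intro sum.cong refl) (simp add: mult.commute)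
  then show ?thesis
    unfolding ricci_def curv_comp_alpha_connection[OF c D D'] \<kappa>_def[symmetric]
    by (simp only: sum.distrib sum_subtractf sum_distrib_left[symmetric])
qed

end

section \<open>Einstein tensors\<close>

lemma trace_adjusted_lincomb:
  assumes "\<And>l k. T l k = r * T1 l k + s * T2 l k + t * T3 l k"
  shows "trace_adjusted A g c p T i j = r * trace_adjusted A g c p T1 i j
    + s * trace_adjusted A g c p T2 i j + t * trace_adjusted A g c p T3 i j"
proof -
  let ?tr = "\<lambda>T. \<Sum>l\<in>UNIV. \<Sum>k\<in>UNIV. inv_metric_comp A g c p l k * T l k"
  have "?tr T = r * ?tr T1 + s * ?tr T2 + t * ?tr T3"
    by (simp add: assms sum_distrib_left sum.distrib algebra_simps)
  then show ?thesis unfolding trace_adjusted_def by (simp add: assms field_simps)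
qed

theorem theorem6p13:
  fixes A :: "('a::{t2_space, second_countable_topology}, 'n::finite) chart set"
    and g :: "'a \<Rightarrow> 'a tvec \<Rightarrow> 'a tvec \<Rightarrow> real"
    and D D' :: "'a connection"
    and \<alpha> :: real
    and c :: "('a, 'n) chart" and p :: 'a and i j :: 'n
  assumes "smooth_structure A"
    and "pseudo_riemannian_metric A g"
    and "affine_connection A D" and "affine_connection A D'"
    and "dual_connections A g D D'"
    and "c \<in> A" and "p \<in> fst c"
  shows "einstein A g c (alpha_connection \<alpha> D D') p i j =
    (1 + \<alpha>) / 2 * einstein A g c D p i j + (1 - \<alpha>) / 2 * einstein A g c D' p i j
      + (1 - \<alpha>\<^sup>2) / 4 * diff_einstein A g c D D' p i j"
proof -
  interpret smooth_manifold A by standard (rule assms(1))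
  show ?thesis
    unfolding einstein_def diff_einstein_def
    by (rule trace_adjusted_lincomb) (rule ricci_alpha_connection[OF assms(6,7,3,4)])
qed

end
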